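(* Let $0<\alpha<2$, let $n\in\mathbb N$, and let $(S_1,\mu_1)$ and $(S_2,\mu_2)$ be measure spaces with positive $\sigma$-finite measures. For $i=1,2$ let $f_1^{(i)},\dots,f_n^{(i)}\in L^\alpha_+(S_i,\mu_i)$ be arbitrary. Then $$\Big\|\sum_{j=1}^n a_j f_j^{(1)}\Big\|_{L^\alpha(S_1,\mu_1)}=\Big\|\sum_{j=1}^n a_j f_j^{(2)}\Big\|_{L^\alpha(S_2,\mu_2)}\quad\text{for all } a_1,\dots,a_n\in\mathbb R$$ if and only if $$\Big\|\bigvee_{j=1}^n a_j f_j^{(1)}\Big\|_{L^\alpha_+(S_1,\mu_1)}=\Big\|\bigvee_{j=1}^n a_j f_j^{(2)}\Big\|_{L^\alpha_+(S_2,\mu_2)}\quad\text{for all } a_1,\dots,a_n\ge 0.$$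
   Context: For a measure space $(S,\mu)$ and $\alpha>0$, $L^\alpha(S,\mu)$ is the space of real measurable functions (modulo $\mu$-a.e. equality) with $\|f\|_{L^\alpha(S,\mu)}=\left(\int_S|f|^\alpha\,d\mu\right)^{1/\alpha}<\infty$ (also when $\alpha<1$), and $L^\alpha_+(S,\mu)=\{f\in L^\alpha(S,\mu): f\ge 0\}$, with the same $\|\cdot\|$. The symbol $\bigvee$ denotes the pointwise maximum. *)

theory Defs
  imports "HOL-Analysis.Analysis"
begin

(* Elements of L^alpha are represented by functions, not by classes modulo a.e. equality.
   The exponent is an arbitrary positive real, possibly below 1. *)
definition L_space :: "real \<Rightarrow> 'a measure \<Rightarrow> ('a \<Rightarrow> real) set" where
  "L_space \<alpha> M = {f \<in> borel_measurable M. integrable M (\<lambda>x. \<bar>f x\<bar> powr \<alpha>)}"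

(* Nonnegativity is required almost everywhere only, since a class is nonnegative iff
   its representatives are nonnegative a.e. *)
definition L_plus :: "real \<Rightarrow> 'a measure \<Rightarrow> ('a \<Rightarrow> real) set" where
  "L_plus \<alpha> M = {f \<in> L_space \<alpha> M. AE x in M. 0 \<le> f x}"

(* Meaningful only for f in L_space: outside it the Bochner integral, and hence L_norm,
   takes the dummy value 0.  For alpha < 1 this is not a norm, as usual. *)
definition L_norm :: "real \<Rightarrow> 'a measure \<Rightarrow> ('a \<Rightarrow> real) \<Rightarrow> real" where
  "L_norm \<alpha> M f = (\<integral>x. \<bar>f x\<bar> powr \<alpha> \<partial>M) powr (1 / \<alpha>)"

end

theory Submission
  imports Defs "HOL-Probability.Probability" "HOL-Real_Asymp.Real_Asymp"
begin

text \<open>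
  Both families of functionals evaluate measures of one kind on regions off the origin. Give the
  half-line \<open>r > 0\<close> the density \<open>\<beta> * r powr (- \<beta> - 1)\<close> and push \<open>M \<Otimes> radial \<beta>\<close> forward under
  \<open>(x, r) \<mapsto> (r * g j x)\<^sub>j\<close>. The substitution \<open>r \<mapsto> r * u\<close> shows that for every nonnegative
  1-homogeneous \<open>h\<close> the measure of \<open>{y. 1 \<le> h y}\<close> is \<open>\<integral> h(g x) powr \<beta> dM\<close>. Such a
  measure is the exponent measure of a max-stable vector and, if \<open>\<beta> < 2\<close>, the Levy measure of a
  stable one.

  From maxima to sums. Take \<open>\<beta> = \<alpha>\<close> and \<open>g = f\<close>. The max-functionals are the masses of the
  complements of boxes \<open>{y. \<forall>j. y j < b j}\<close>, and these determine the measure away from the origin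
  because differences of such complements form an intersection-stable generator
  (\<open>emeasure_eq_of_upper_tails\<close>). The sum-functional with coefficients \<open>a\<close> is the mass of
  \<open>{y. 1 \<le> \<bar>\<Sum>j. a j * y j\<bar>}\<close>, which stays away from the origin.

  From sums to maxima. Averaging \<open>\<bar>\<Sum>j. a j * f j\<bar> powr \<alpha>\<close> over independent centred Gaussian
  coefficients of variance \<open>s j\<close> gives a constant times \<open>(\<Sum>j. s j * (f j)\<^sup>2) powr (\<alpha> / 2)\<close>
  (\<open>gauss_average\<close>). Now \<open>\<beta> = \<alpha> / 2 < 1\<close>; this is where \<open>\<alpha> < 2\<close> is needed. For the measure built
  from \<open>\<beta>\<close> and \<open>g = f\<^sup>2\<close> these numbers are, up to a finite constant, the integrals of
  \<open>1 - exp (- (\<Sum>j. s j * y j))\<close>, so two such measures have the same Laplace data. Explicit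
  combinations of exponentials converge to the indicator of a box, with an integrable bound on
  what is removed near the origin; hence the measures agree on complements of boxes
  (\<open>emeasure_eq_of_Laplace\<close>), and those masses are the max-functionals. Squaring loses nothing
  because the functions are nonnegative.
\<close>

section \<open>The radial measure\<close>

definition radial :: "real \<Rightarrow> real measure" where
  "radial \<beta> = density lborel (\<lambda>r. ennreal (\<beta> * r powr (- \<beta> - 1)) * indicator {0<..} r)"

lemma sets_radial [simp, measurable_cong]: "sets (radial \<beta>) = sets borel"
  by (simp add: radial_def)

lemma space_radial [simp]: "space (radial \<beta>) = UNIV"
  by (simp add: radial_def)

lemma sigma_finite_radial: "sigma_finite_measure (radial \<beta>)"
  unfolding radial_def
  by (subst sigma_finite_measure.sigma_finite_iff_density_finite[OF sigma_finite_lborel])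
     (auto simp: indicator_def)

lemma nn_integral_radial:
  assumes [measurable]: "\<phi> \<in> borel_measurable borel"
  shows "(\<integral>\<^sup>+r. \<phi> r \<partial>radial \<beta>) =
    (\<integral>\<^sup>+r. ennreal (\<beta> * r powr (- \<beta> - 1)) * indicator {0<..} r * \<phi> r \<partial>lborel)"
  unfolding radial_def by (subst nn_integral_density) auto

text \<open>Dilating the half-line by \<open>u\<close> multiplies the radial measure by \<open>u powr \<beta>\<close>; everything below rests
  on this. The absolute value changes nothing on the support, but keeps the argument of \<open>\<phi>\<close>
  nonnegative for every \<open>r\<close>. The hypothesis \<open>\<phi> 0 = 0\<close> is what makes the case \<open>u = 0\<close> come out right,
  as the total mass is infinite.\<close>

lemma nn_integral_radial_scale:
  fixes \<phi> :: "real \<Rightarrow> ennreal"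
  assumes [measurable]: "\<phi> \<in> borel_measurable borel"
    and "\<phi> 0 = 0" and "0 \<le> u" and \<beta>: "0 < \<beta>"
  shows "(\<integral>\<^sup>+r. \<phi> (\<bar>r\<bar> * u) \<partial>radial \<beta>) = ennreal (u powr \<beta>) * (\<integral>\<^sup>+r. \<phi> r \<partial>radial \<beta>)"
proof (cases "u = 0")
  case False
  then have u: "0 < u" using \<open>0 \<le> u\<close> by simp
  let ?F = "\<lambda>r. ennreal (\<beta> * r powr (- \<beta> - 1)) * indicator {0<..} r * \<phi> r"
  have eq: "ennreal (u powr \<beta>) * (ennreal u * ?F (0 + u * r)) =
      ennreal (\<beta> * r powr (- \<beta> - 1)) * indicator {0<..} r * \<phi> (\<bar>r\<bar> * u)" for r
  proof (cases "0 < r")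
    case True
    have p: "u powr (1 + \<beta>) * u powr (- \<beta> - 1) = 1"
      using u by (simp flip: powr_add)
    have "u powr \<beta> * (u * (\<beta> * (u * r) powr (- \<beta> - 1)))
        = (u powr (1 + \<beta>) * u powr (- \<beta> - 1)) * (\<beta> * r powr (- \<beta> - 1))"
      using u True by (simp add: powr_mult powr_add mult_ac)
    then have "u powr \<beta> * (u * (\<beta> * (u * r) powr (- \<beta> - 1))) = \<beta> * r powr (- \<beta> - 1)"
      unfolding p by simp
    then have e: "ennreal (\<beta> * r powr (- \<beta> - 1)) =
        ennreal (u powr \<beta>) * (ennreal u * ennreal (\<beta> * (u * r) powr (- \<beta> - 1)))"
      using u \<beta> by (simp flip: ennreal_mult)
    show ?thesis
      unfolding e using u True by (simp add: mult.assoc mult.commute[of r])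
  next
    case False
    then have "\<not> 0 < u * r" using u by (simp add: zero_less_mult_iff)
    with False show ?thesis by (simp add: indicator_def)
  qed
  have "(\<integral>\<^sup>+r. \<phi> r \<partial>radial \<beta>) = ennreal u * (\<integral>\<^sup>+r. ?F (0 + u * r) \<partial>lborel)"
    by (simp only: nn_integral_radial[OF assms(1)], subst nn_integral_real_affine[where c=u and t=0])
       (use u in \<open>auto\<close>)
  then have "ennreal (u powr \<beta>) * (\<integral>\<^sup>+r. \<phi> r \<partial>radial \<beta>)
      = (\<integral>\<^sup>+r. ennreal (u powr \<beta>) * (ennreal u * ?F (0 + u * r)) \<partial>lborel)"
    by (simp add: nn_integral_cmult)
  also have "\<dots> = (\<integral>\<^sup>+r. \<phi> (\<bar>r\<bar> * u) \<partial>radial \<beta>)"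
    unfolding eq by (subst nn_integral_radial) auto
  finally show ?thesis by simp
qed (use assms in simp)

lemma emeasure_radial_atLeast_1: "0 < \<beta> \<Longrightarrow> emeasure (radial \<beta>) {1..} = 1"
proof -
  assume \<beta>: "0 < \<beta>"
  have lim: "((\<lambda>x::real. - (x powr (-\<beta>))) \<longlongrightarrow> 0) at_top"
    using \<beta> by real_asymp
  have "emeasure (radial \<beta>) {1..} = (\<integral>\<^sup>+r. indicator {1..} r \<partial>radial \<beta>)" by simp
  also have "\<dots> = (\<integral>\<^sup>+r. ennreal (\<beta> * r powr (- \<beta> - 1)) * indicator {1..} r \<partial>lborel)"
    by (subst nn_integral_radial) (auto intro!: nn_integral_cong simp: indicator_def)
  also have "\<dots> = ennreal (0 - (- (1 powr (-\<beta>))))"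
    by (rule nn_integral_FTC_atLeast[OF _ _ _ lim])
       (use \<beta> in \<open>auto intro!: derivative_eq_intros\<close>)
  finally show ?thesis by simp
qed

text \<open>Integrability at \<open>0\<close> is the Levy condition for a subordinator, and it forces \<open>\<beta> < 1\<close>.\<close>

lemma nn_integral_radial_min_1_finite:
  assumes "0 < \<beta>" "\<beta> < 1"
  shows "(\<integral>\<^sup>+r. ennreal (min 1 r) \<partial>radial \<beta>) < \<infinity>"
proof -
  have "(\<integral>\<^sup>+r. ennreal (min 1 r) \<partial>radial \<beta>)
      \<le> (\<integral>\<^sup>+r. ennreal (\<beta> * r powr (-\<beta>)) * indicator {0..1} r \<partial>lborel)
        + (\<integral>\<^sup>+r. indicator {1..} r \<partial>radial \<beta>)"
  proof -
    have le: "ennreal (\<beta> * r powr (- \<beta> - 1)) * indicator {0<..} r * ennreal (min 1 r)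
        \<le> ennreal (\<beta> * r powr (-\<beta>)) * indicator {0..1} r
          + ennreal (\<beta> * r powr (- \<beta> - 1)) * indicator {0<..} r * indicator {1..} r" for r
    proof -
      have "r powr (- \<beta> - 1) * r = r powr (- \<beta>)" if "0 < r"
        using that powr_mult_base[of r "- \<beta> - 1"] by (simp add: mult.commute)
      then show ?thesis
        using assms by (auto simp: indicator_def min_def mult.assoc simp flip: ennreal_mult)
    qed
    show ?thesis
      by (subst (1 2) nn_integral_radial, simp, simp, subst nn_integral_add[symmetric])
         (auto intro!: nn_integral_mono le)
  qed
  also have "(\<integral>\<^sup>+r. ennreal (\<beta> * r powr (-\<beta>)) * indicator {0..1} r \<partial>lborel) < \<infinity>"
  proof -
    have "((\<lambda>r. \<beta> * r powr (-\<beta>)) has_integral (\<beta> * (1 powr (-\<beta> + 1) / (-\<beta> + 1)))) {0..1}"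
      by (intro has_integral_mult_right has_integral_powr_from_0) (use assms in auto)
    then have "(\<integral>\<^sup>+r. ennreal (\<beta> * r powr (-\<beta>)) * indicator {0..1} r \<partial>lborel)
        = ennreal (\<beta> * (1 powr (-\<beta> + 1) / (-\<beta> + 1)))"
      by (intro nn_integral_has_integral_lebesgue') (use assms in auto)
    then show ?thesis by simp
  qed
  finally show ?thesis
    using emeasure_radial_atLeast_1[of \<beta>] assms by (simp add: less_top)
qed

section \<open>The measure generated by rescaling a family of functions\<close>

text \<open>In polar terms this is the measure with radial part \<open>radial \<beta>\<close> whose spectral measure is carried
  by the directions of the vectors \<open>(g j x)\<^sub>j\<close>. Scaling by \<open>\<bar>r\<bar>\<close> instead of \<open>r\<close> alters only a null set
  and, for nonnegative \<open>g\<close>, yields points of the orthant without exception.\<close>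

definition ray_measure :: "real \<Rightarrow> 'i set \<Rightarrow> 'a measure \<Rightarrow> ('i \<Rightarrow> 'a \<Rightarrow> real) \<Rightarrow> ('i \<Rightarrow> real) measure"
  where "ray_measure \<beta> I M g =
    distr (M \<Otimes>\<^sub>M radial \<beta>) (\<Pi>\<^sub>M j\<in>I. borel) (\<lambda>(x, r). \<lambda>j\<in>I. \<bar>r\<bar> * g j x)"

lemma sets_ray_measure [simp, measurable_cong]:
  "sets (ray_measure \<beta> I M g) = sets (\<Pi>\<^sub>M j\<in>I. borel)"
  by (simp add: ray_measure_def)

lemma space_ray_measure: "space (ray_measure \<beta> I M g) = (\<Pi>\<^sub>E j\<in>I. UNIV)"
  by (simp add: ray_measure_def space_PiM)

lemma AE_ray_measure_nonneg:
  assumes g: "\<And>j. j \<in> I \<Longrightarrow> g j \<in> borel_measurable M" and I: "finite I"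
    and pos: "\<And>j x. j \<in> I \<Longrightarrow> 0 \<le> g j x"
  shows "AE y in ray_measure \<beta> I M g. \<forall>j\<in>I. 0 \<le> y j"
  unfolding ray_measure_def
proof (subst AE_distr_iff)
  show "{y \<in> space (\<Pi>\<^sub>M j\<in>I. borel). \<forall>j\<in>I. 0 \<le> y j} \<in> sets (\<Pi>\<^sub>M j\<in>I. borel :: real measure)"
    using I by measurable
  show "(\<lambda>(x, r). \<lambda>j\<in>I. \<bar>r\<bar> * g j x) \<in> M \<Otimes>\<^sub>M radial \<beta> \<rightarrow>\<^sub>M (\<Pi>\<^sub>M j\<in>I. borel)"
    using g by (auto intro!: measurable_restrict borel_measurable_times simp: split_beta')
qed (use pos in auto)

text \<open>Along each ray a 1-homogeneous \<open>h\<close> is linear, so the radial integral is a dilation and splits off as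
  a factor that does not depend on \<open>g\<close>.\<close>

lemma nn_integral_ray_measure:
  fixes \<phi> :: "real \<Rightarrow> ennreal" and h :: "('i \<Rightarrow> real) \<Rightarrow> real"
  assumes g: "\<And>j. j \<in> I \<Longrightarrow> g j \<in> borel_measurable M"
    and \<phi>[measurable]: "\<phi> \<in> borel_measurable borel" and "\<phi> 0 = 0" and "0 < \<beta>"
    and h[measurable]: "h \<in> borel_measurable (\<Pi>\<^sub>M j\<in>I. borel)"
    and hom: "\<And>r x. 0 \<le> r \<Longrightarrow> h (\<lambda>j\<in>I. r * g j x) = r * h (\<lambda>j\<in>I. g j x)"
    and pos: "\<And>x. 0 \<le> h (\<lambda>j\<in>I. g j x)"
  shows "(\<integral>\<^sup>+y. \<phi> (h y) \<partial>ray_measure \<beta> I M g) =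
    (\<integral>\<^sup>+x. ennreal (h (\<lambda>j\<in>I. g j x) powr \<beta>) \<partial>M) * (\<integral>\<^sup>+r. \<phi> r \<partial>radial \<beta>)"
proof -
  interpret R: sigma_finite_measure "radial \<beta>" by (rule sigma_finite_radial)
  have [measurable]: "(\<lambda>x. \<lambda>j\<in>I. g j x) \<in> M \<rightarrow>\<^sub>M (\<Pi>\<^sub>M j\<in>I. borel)"
    by (intro measurable_restrict g)
  have [measurable]: "(\<lambda>(x, r). \<lambda>j\<in>I. \<bar>r\<bar> * g j x) \<in> M \<Otimes>\<^sub>M radial \<beta> \<rightarrow>\<^sub>M (\<Pi>\<^sub>M j\<in>I. borel)"
    using g by (auto intro!: measurable_restrict borel_measurable_times simp: split_beta')
  have "(\<integral>\<^sup>+y. \<phi> (h y) \<partial>ray_measure \<beta> I M g)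
      = (\<integral>\<^sup>+p. \<phi> (h ((\<lambda>(x, r). \<lambda>j\<in>I. \<bar>r\<bar> * g j x) p)) \<partial>(M \<Otimes>\<^sub>M radial \<beta>))"
    unfolding ray_measure_def by (subst nn_integral_distr) auto
  also have "\<dots> = (\<integral>\<^sup>+x. \<integral>\<^sup>+r. \<phi> (h (\<lambda>j\<in>I. \<bar>r\<bar> * g j x)) \<partial>radial \<beta> \<partial>M)"
    by (subst R.nn_integral_fst[symmetric]) auto
  also have "\<dots> = (\<integral>\<^sup>+x. ennreal (h (\<lambda>j\<in>I. g j x) powr \<beta>) * (\<integral>\<^sup>+r. \<phi> r \<partial>radial \<beta>) \<partial>M)"
    by (simp add: hom nn_integral_radial_scale pos assms(3,4))
  also have "\<dots> = (\<integral>\<^sup>+x. ennreal (h (\<lambda>j\<in>I. g j x) powr \<beta>) \<partial>M) * (\<integral>\<^sup>+r. \<phi> r \<partial>radial \<beta>)"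
    by (rule nn_integral_multc) measurable
  finally show ?thesis .
qed

lemma emeasure_ray_measure_atLeast_1:
  fixes h :: "('i \<Rightarrow> real) \<Rightarrow> real"
  assumes g: "\<And>j. j \<in> I \<Longrightarrow> g j \<in> borel_measurable M" and "0 < \<beta>"
    and h[measurable]: "h \<in> borel_measurable (\<Pi>\<^sub>M j\<in>I. borel)"
    and hom: "\<And>r x. 0 \<le> r \<Longrightarrow> h (\<lambda>j\<in>I. r * g j x) = r * h (\<lambda>j\<in>I. g j x)"
    and pos: "\<And>x. 0 \<le> h (\<lambda>j\<in>I. g j x)"
  shows "emeasure (ray_measure \<beta> I M g) {y \<in> space (\<Pi>\<^sub>M j\<in>I. borel). 1 \<le> h y} =
    (\<integral>\<^sup>+x. ennreal (h (\<lambda>j\<in>I. g j x) powr \<beta>) \<partial>M)"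
proof -
  have sp: "space (ray_measure \<beta> I M g) = space (\<Pi>\<^sub>M j\<in>I. borel)"
    by (rule sets_eq_imp_space_eq) simp
  have "emeasure (ray_measure \<beta> I M g) {y \<in> space (\<Pi>\<^sub>M j\<in>I. borel). 1 \<le> h y}
      = (\<integral>\<^sup>+y. indicator {1..} (h y) \<partial>ray_measure \<beta> I M g)"
    by (subst nn_integral_indicator[symmetric])
       (auto intro!: nn_integral_cong simp: indicator_def sp simp del: nn_integral_indicator)
  also have "\<dots> = (\<integral>\<^sup>+x. ennreal (h (\<lambda>j\<in>I. g j x) powr \<beta>) \<partial>M)"
    by (subst nn_integral_ray_measure[OF g])
       (use assms(2) in \<open>auto simp: hom pos emeasure_radial_atLeast_1\<close>)
  finally show ?thesis .
qed

section \<open>Elementary bounds for sums and maxima\<close>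

lemma powr_abs_sum_le:
  fixes x :: "'i \<Rightarrow> real"
  assumes I: "finite I" and \<alpha>: "0 < \<alpha>"
  shows "\<bar>\<Sum>j\<in>I. x j\<bar> powr \<alpha> \<le> (\<Sum>j\<in>I. (card I * \<bar>x j\<bar>) powr \<alpha>)"
proof (cases "I = {}")
  case False
  let ?m = "Max ((\<lambda>j. \<bar>x j\<bar>) ` I)"
  obtain k where k: "k \<in> I" "?m = \<bar>x k\<bar>"
    using Max_in[of "(\<lambda>j. \<bar>x j\<bar>) ` I"] I False by (auto simp: image_iff)
  have "\<bar>\<Sum>j\<in>I. x j\<bar> \<le> (\<Sum>j\<in>I. \<bar>x j\<bar>)" by (rule sum_abs)
  also have "\<dots> \<le> card I * \<bar>x k\<bar>"
    using I by (intro sum_bounded_above) (simp flip: k(2))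
  finally have "\<bar>\<Sum>j\<in>I. x j\<bar> powr \<alpha> \<le> (card I * \<bar>x k\<bar>) powr \<alpha>"
    using \<alpha> by (intro powr_mono2) auto
  also have "\<dots> \<le> (\<Sum>j\<in>I. (card I * \<bar>x j\<bar>) powr \<alpha>)"
    using I k(1) by (intro member_le_sum) auto
  finally show ?thesis .
qed (use \<alpha> in simp)

lemma powr_abs_Max_le:
  fixes x :: "'i \<Rightarrow> real"
  assumes I: "finite I" "I \<noteq> {}"
  shows "\<bar>MAX j\<in>I. x j\<bar> powr \<alpha> \<le> (\<Sum>j\<in>I. \<bar>x j\<bar> powr \<alpha>)"
proof -
  obtain k where k: "k \<in> I" "(MAX j\<in>I. x j) = x k"
    using Max_in[of "x ` I"] I by (auto simp: image_iff)
  show ?thesis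
    unfolding k(2) using I k(1) by (intro member_le_sum) auto
qed

lemma MAX_mult_left:
  fixes x :: "'i \<Rightarrow> real"
  assumes "finite I" "I \<noteq> {}" "0 \<le> r"
  shows "(MAX j\<in>I. r * x j) = r * (MAX j\<in>I. x j)"
proof -
  have "mono ((*) r)" using assms by (auto intro!: monoI mult_left_mono)
  from mono_Max_commute[OF this, of "x ` I"] show ?thesis
    using assms by (simp add: image_image)
qed

section \<open>Determination by complements of boxes\<close>

text \<open>Complements of boxes are not intersection-stable and may exhaust an infinite measure, so they are
  used through differences: with \<open>K b = {y. \<exists>j. b j \<le> y j}\<close>, the part of the box with corner \<open>b\<close> that
  lies in \<open>K c\<close> is \<open>K (min b c) - K b\<close>. Restricted to \<open>K c\<close> both measures are finite and agree on all
  boxes, which generate the product sigma-algebra. Boxes with a nonpositive corner miss the orthant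
  because they are open above.\<close>

lemma emeasure_eq_of_upper_tails:
  fixes N1 N2 :: "('i \<Rightarrow> real) measure"
  assumes I: "finite I"
    and sets1: "sets N1 = sets (\<Pi>\<^sub>M j\<in>I. borel)" and sets2: "sets N2 = sets (\<Pi>\<^sub>M j\<in>I. borel)"
    and pos1: "AE y in N1. \<forall>j\<in>I. 0 \<le> y j" and pos2: "AE y in N2. \<forall>j\<in>I. 0 \<le> y j"
    and tails: "\<And>b. (\<And>j. j \<in> I \<Longrightarrow> 0 < b j) \<Longrightarrow>
        emeasure N1 {y \<in> space N1. \<exists>j\<in>I. b j \<le> y j} = emeasure N2 {y \<in> space N2. \<exists>j\<in>I. b j \<le> y j}"
    and fin: "\<And>b. (\<And>j. j \<in> I \<Longrightarrow> 0 < b j) \<Longrightarrow> emeasure N1 {y \<in> space N1. \<exists>j\<in>I. b j \<le> y j} < \<infinity>"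
    and A: "A \<in> sets (\<Pi>\<^sub>M j\<in>I. borel)"
    and c: "0 < c" "\<And>y. y \<in> A \<Longrightarrow> (\<forall>j\<in>I. 0 \<le> y j) \<Longrightarrow> \<exists>j\<in>I. c \<le> y j"
  shows "emeasure N1 A = emeasure N2 A"
proof -
  let ?P = "\<Pi>\<^sub>M j\<in>I. borel :: real measure"
  have sp1: "space N1 = space ?P" and sp2: "space N2 = space ?P"
    using sets1 sets2 by (auto dest: sets_eq_imp_space_eq)
  note [measurable_cong] = sets1 sets2
  define K where "K b = {y \<in> space ?P. \<exists>j\<in>I. b j \<le> y j}" for b :: "'i \<Rightarrow> real"
  have K[measurable]: "K b \<in> sets ?P" for b
    unfolding K_def using I by measurable
  have tailsK: "emeasure N1 (K b) = emeasure N2 (K b)" "emeasure N1 (K b) < \<infinity>"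
    if "\<And>j. j \<in> I \<Longrightarrow> 0 < b j" for b
    using tails[OF that] fin[OF that] by (simp_all add: sp1 sp2 K_def)
  let ?C = "K (\<lambda>_. c)"
  define E where "E = range (\<lambda>b::'i \<Rightarrow> real. Pi\<^sub>E I (\<lambda>j. {..<b j}))"
  have E_sets: "X \<in> sets ?P" if "X \<in> E" for X
    using that I unfolding E_def by (auto intro!: sets_PiM_I_finite)
  have "density N1 (indicator ?C) = density N2 (indicator ?C)"
  proof (rule measure_eqI_generator_eq[where E=E and \<Omega>="space ?P" and A="\<lambda>k. Pi\<^sub>E I (\<lambda>_. {..<real k})"])
    show "Int_stable E"
    proof (rule Int_stableI)
      fix X Y assume "X \<in> E" "Y \<in> E"
      then obtain a b where "X = Pi\<^sub>E I (\<lambda>j. {..<a j})" "Y = Pi\<^sub>E I (\<lambda>j. {..<b j})"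
        unfolding E_def by auto
      then have "X \<inter> Y = Pi\<^sub>E I (\<lambda>j. {..<min (a j) (b j)})"
        by (auto simp: PiE_def Pi_def)
      then show "X \<inter> Y \<in> E"
        unfolding E_def by auto
    qed
    show "E \<subseteq> Pow (space ?P)"
      using E_sets sets.sets_into_space by blast
    have gen: "sets ?P = sigma_sets (space ?P) E"
    proof -
      have "sets ?P = sets (\<Pi>\<^sub>M j\<in>I. sigma UNIV (range lessThan))"
        by (simp flip: borel_Iio)
      also have "\<dots> = sets (sigma (\<Pi>\<^sub>E i\<in>I. UNIV)
          {{f \<in> \<Pi>\<^sub>E i\<in>I. UNIV. \<forall>i\<in>j. f i \<in> F i} | F j. j \<in> {I} \<and> F \<in> Pi j (\<lambda>_. range lessThan)})"
      proof (rule sets_PiM_sigma)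
        have "(\<Union>k. {..<real k}) = UNIV" using reals_Archimedean2 by auto
        then show "\<exists>S\<subseteq>range lessThan. countable S \<and> (UNIV :: real set) = \<Union>S"
          by (intro exI[of _ "range (\<lambda>k. {..<real k})"]) auto
      qed (use I in auto)
      also have "{{f \<in> \<Pi>\<^sub>E i\<in>I. UNIV. \<forall>i\<in>j. f i \<in> F i} | F j. j \<in> {I} \<and> F \<in> Pi j (\<lambda>_. range
          lessThan)} = E"
        (is "?L = E")
      proof (intro set_eqI iffI)
        fix X assume "X \<in> ?L"
        then obtain F where F: "X =
            {f \<in> \<Pi>\<^sub>E i\<in>I. UNIV. \<forall>i\<in>I. f i \<in> F i}" "\<And>i. i \<in> I \<Longrightarrow> F i \<in> range lessThan"
          by auto
        have "\<forall>i\<in>I. \<exists>b. F i = {..<b}" using F(2) by blast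
        then obtain b where "\<And>i. i \<in> I \<Longrightarrow> F i = {..<b i}" by metis
        then have "X = Pi\<^sub>E I (\<lambda>j. {..<b j})" unfolding F(1) by (auto simp: PiE_def Pi_def)
        then show "X \<in> E" unfolding E_def by simp
      next
        fix X assume "X \<in> E"
        then obtain b where b: "X = Pi\<^sub>E I (\<lambda>j. {..<b j})" unfolding E_def by auto
        show "X \<in> ?L"
          by (rule CollectI, intro exI[of _ "\<lambda>j. {..<b j}"] exI[of _ I])
             (auto simp: b PiE_def Pi_def)
      qed
      finally show ?thesis
        using \<open>E \<subseteq> Pow (space ?P)\<close> by (simp add: space_PiM sets_measure_of)
    qed
    show "sets (density N1 (indicator ?C)) = sigma_sets (space ?P) E"
      "sets (density N2 (indicator ?C)) = sigma_sets (space ?P) E"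
      using gen sets1 sets2 by auto
    show "range (\<lambda>k. Pi\<^sub>E I (\<lambda>_. {..<real k})) \<subseteq> E"
      unfolding E_def by auto
    show "(\<Union>k. Pi\<^sub>E I (\<lambda>_. {..<real k})) = space ?P"
    proof -
      have "\<exists>k. \<forall>j\<in>I. y j < real k" for y :: "'i \<Rightarrow> real"
      proof -
        obtain k where "Max (insert 0 (y ` I)) < real k" using reals_Archimedean2 by blast
        then show ?thesis using I by (auto intro!: exI[of _ k])
      qed
      then have "\<forall>y. \<exists>k. \<forall>j\<in>I. y j < real k" by blast
      then show ?thesis by (force simp: space_PiM PiE_def Pi_def)
    qed
    have dens: "emeasure (density N (indicator ?C)) X = emeasure N (?C \<inter> X)"
      if "sets N = sets ?P" "X \<in> sets ?P" for N X
      using that by (subst emeasure_density)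
        (auto simp: nn_integral_indicator[symmetric] indicator_inter_arith[symmetric] simp del:
            nn_integral_indicator)
    show "emeasure (density N1 (indicator ?C)) (Pi\<^sub>E I (\<lambda>_. {..<real k})) \<noteq> \<infinity>" for k
    proof -
      have "Pi\<^sub>E I (\<lambda>_. {..<real k}) \<in> sets ?P" using I by (auto intro!: sets_PiM_I_finite)
      then have "emeasure (density N1 (indicator ?C)) (Pi\<^sub>E I (\<lambda>_. {..<real k})) \<le> emeasure N1 ?C"
        by (subst dens) (auto intro!: emeasure_mono simp: sets1)
      also have "\<dots> < \<infinity>" using c by (intro tailsK)
      finally show ?thesis by simp
    qed
    fix X assume X: "X \<in> E"
    then obtain b where b: "X = Pi\<^sub>E I (\<lambda>j. {..<b j})"
      unfolding E_def by auto
    have "emeasure N1 (?C \<inter> X) = emeasure N2 (?C \<inter> X)"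
    proof (cases "\<forall>j\<in>I. 0 < b j")
      case True
      \<comment> \<open>Both sets on the right have finite mass, unlike, in general, the box itself.\<close>
      have eq: "?C \<inter> X = K (\<lambda>j. min (b j) c) - K b"
        by (force simp: b K_def space_PiM PiE_def Pi_def not_le min_le_iff_disj)
      have sub: "K b \<subseteq> K (\<lambda>j. min (b j) c)"
        by (auto simp: K_def min_le_iff_disj)
      have fin: "emeasure N1 (K b) \<noteq> \<infinity>" "emeasure N2 (K b) \<noteq> \<infinity>"
        using tailsK[of b] True by auto
      have "emeasure N1 (?C \<inter> X) = emeasure N1 (K (\<lambda>j. min (b j) c)) - emeasure N1 (K b)"
        unfolding eq using fin sub by (intro emeasure_Diff) (auto simp: sets1)
      also have "\<dots> = emeasure N2 (K (\<lambda>j. min (b j) c)) - emeasure N2 (K b)"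
        using True c(1) by (simp add: tailsK)
      also have "\<dots> = emeasure N2 (?C \<inter> X)"
        unfolding eq using fin sub by (intro emeasure_Diff[symmetric]) (auto simp: sets2)
      finally show ?thesis .
    next
      case False
      then obtain j where j: "j \<in> I" "b j \<le> 0" by (auto simp: not_less)
      have null: "emeasure N (?C \<inter> X) = 0" if "AE y in N. \<forall>j\<in>I. 0 \<le> y j" "sets N = sets ?P" for N
      proof -
        have "AE x in N. x \<notin> ?C \<inter> X"
          using that(1) by eventually_elim (use j in \<open>fastforce simp: b PiE_def Pi_def\<close>)
        moreover have "?C \<inter> X \<in> sets N" using E_sets[OF X] that(2) by auto
        ultimately have "?C \<inter> X \<in> null_sets N" by (subst AE_iff_null_sets)
        then show ?thesis by (rule null_setsD1)
      qed
      show ?thesis by (simp only: null[OF pos1 sets1] null[OF pos2 sets2])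
    qed
    then show "emeasure (density N1 (indicator ?C)) X = emeasure (density N2 (indicator ?C)) X"
      using E_sets[OF X] sets1 sets2 by (simp add: dens)
  qed
  moreover have restr: "emeasure N A = emeasure (density N (indicator ?C)) A"
    if "AE y in N. \<forall>j\<in>I. 0 \<le> y j" "sets N = sets ?P" for N
  proof -
    note [measurable_cong] = that(2)
    have "emeasure N A = (\<integral>\<^sup>+y. indicator A y \<partial>N)" using A that(2) by simp
    also have "\<dots> = (\<integral>\<^sup>+y. indicator ?C y * indicator A y \<partial>N)"
      using that(1) AE_space
    proof (intro nn_integral_cong_AE, eventually_elim)
      fix y assume "\<forall>j\<in>I. 0 \<le> y j" "y \<in> space N"
      then show "indicator A y = (indicator ?C y * indicator A y :: ennreal)"
        using c(2)[of y] sets_eq_imp_space_eq[OF that(2)] by (auto simp: K_def indicator_def)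
    qed
    also have "\<dots> = emeasure (density N (indicator ?C)) A"
      using A by (subst emeasure_density) auto
    finally show ?thesis .
  qed
  ultimately show ?thesis by (simp only: restr[OF pos1 sets1] restr[OF pos2 sets2])
qed

section \<open>Determination by Laplace functionals\<close>

text \<open>Linear combinations of the Laplace kernels with nonnegative frequencies. They form an algebra, and
  the integral of \<open>P (\<lambda>_. 0) - P\<close> is linear in \<open>P\<close>; thus equality of the Laplace functionals passes
  to products of such combinations although the measures themselves may be infinite.\<close>

inductive_set exp_span :: "'i set \<Rightarrow> (('i \<Rightarrow> real) \<Rightarrow> real) set" for I where
  exp: "(\<And>j. j \<in> I \<Longrightarrow> 0 \<le> s j) \<Longrightarrow> (\<lambda>y. exp (- (\<Sum>j\<in>I. s j * y j))) \<in> exp_span I"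
| add: "P \<in> exp_span I \<Longrightarrow> Q \<in> exp_span I \<Longrightarrow> (\<lambda>y. P y + Q y) \<in> exp_span I"
| scale: "P \<in> exp_span I \<Longrightarrow> (\<lambda>y. c * P y) \<in> exp_span I"

lemma exp_span_const: "(\<lambda>_. c) \<in> exp_span I"
  using exp_span.scale[OF exp_span.exp[of I "\<lambda>_. 0"], of c] by simp

lemma exp_span_mult: "P \<in> exp_span I \<Longrightarrow> Q \<in> exp_span I \<Longrightarrow> (\<lambda>y. P y * Q y) \<in> exp_span I"
proof (induction rule: exp_span.induct)
  case (exp s)
  from exp.prems show ?case
  proof (induction rule: exp_span.induct)
    case (exp t)
    have "(\<lambda>y. exp (- (\<Sum>j\<in>I. (s j + t j) * y j))) \<in> exp_span I"
      using exp \<open>\<And>j. j \<in> I \<Longrightarrow> 0 \<le> s j\<close> by (intro exp_span.exp) auto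
    then show ?case
      by (simp add: ring_distribs sum.distrib exp_add[symmetric] algebra_simps)
  next
    case (add P Q)
    then show ?case using exp_span.add by (fastforce simp: ring_distribs)
  next
    case (scale P c)
    then show ?case using exp_span.scale[of _ I c] by (fastforce simp: mult.left_commute)
  qed
next
  case (add P R)
  then show ?case using exp_span.add by (fastforce simp: ring_distribs)
next
  case (scale P c)
  then show ?case using exp_span.scale[of _ I c] by (fastforce simp: mult.assoc)
qed

lemma exp_span_power: "P \<in> exp_span I \<Longrightarrow> (\<lambda>y. P y ^ m) \<in> exp_span I"
  by (induction m) (auto intro: exp_span_const exp_span_mult)

lemma exp_span_prod: "(\<And>j. j \<in> J \<Longrightarrow> P j \<in> exp_span I) \<Longrightarrow> (\<lambda>y. \<Prod>j\<in>J. P j y) \<in> exp_span I"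
  by (induction J rule: infinite_finite_induct) (auto intro: exp_span_const exp_span_mult)

lemma exp_span_diff: "P \<in> exp_span I \<Longrightarrow> Q \<in> exp_span I \<Longrightarrow> (\<lambda>y. P y - Q y) \<in> exp_span I"
  using exp_span.add[OF _ exp_span.scale[of Q I "-1"], of P] by simp

lemma exp_span_exp_single:
  assumes "finite I" "j \<in> I" "0 \<le> (c::real)"
  shows "(\<lambda>y. exp (- (c * y j))) \<in> exp_span I"
proof -
  have "(\<lambda>y. exp (- (\<Sum>i\<in>I. (if i = j then c else 0) * y i))) \<in> exp_span I"
    using assms by (intro exp_span.exp) auto
  then show ?thesis using assms by (simp add: if_distrib[of "\<lambda>x. x * _"] cong: if_cong)
qed

lemma min_1_sum_le:
  fixes x :: "'i \<Rightarrow> real"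
  assumes "finite I" "\<And>j. j \<in> I \<Longrightarrow> 0 \<le> x j"
  shows "min 1 (\<Sum>j\<in>I. x j) \<le> (\<Sum>j\<in>I. min 1 (x j))"
  using assms
proof (induction I rule: finite_induct)
  case (insert i I)
  then have "0 \<le> sum x I" "0 \<le> x i" by (auto intro: sum_nonneg)
  moreover have "min 1 (sum x I) \<le> (\<Sum>j\<in>I. min 1 (x j))" using insert by auto
  ultimately have "min 1 (x i + sum x I) \<le> min 1 (x i) + (\<Sum>j\<in>I. min 1 (x j))" by linarith
  then show ?case using insert by simp
qed simp

text \<open>Subtracting from the value at the origin cancels the infinite mass there: \<open>1 - exp (- t) \<le> min 1 t\<close>,
  and the truncated coordinates are integrable.\<close>

lemma integrable_exp_span:
  assumes I: "finite I" and sets: "sets N = sets (\<Pi>\<^sub>M j\<in>I. borel)"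
    and pos: "AE y in N. \<forall>j\<in>I. 0 \<le> y j"
    and int: "\<And>j. j \<in> I \<Longrightarrow> integrable N (\<lambda>y. min 1 (y j))"
    and P: "P \<in> exp_span I"
  shows "integrable N (\<lambda>y. P (\<lambda>_. 0) - P y)"
  using P
proof induction
  case (exp s)
  note [measurable_cong] = sets
  have bd: "\<bar>1 - exp (- (\<Sum>j\<in>I. s j * y j))\<bar> \<le> (\<Sum>j\<in>I. max 1 (s j) * min 1 (y j))"
    if y: "\<forall>j\<in>I. 0 \<le> y j" for y
  proof -
    let ?x = "\<Sum>j\<in>I. s j * y j"
    have x: "0 \<le> ?x" using exp y by (auto intro!: sum_nonneg)
    have "\<bar>1 - exp (- ?x)\<bar> \<le> min 1 ?x"
      using exp_ge_add_one_self[of "- ?x"] x by (auto simp: min_def)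
    also have "\<dots> \<le> (\<Sum>j\<in>I. min 1 (s j * y j))"
      using exp y I by (intro min_1_sum_le) auto
    also have "\<dots> \<le> (\<Sum>j\<in>I. max 1 (s j) * min 1 (y j))"
    proof (rule sum_mono)
      fix j assume "j \<in> I"
      then have "s j * y j \<le> max 1 (s j) * y j" "0 \<le> y j"
        using y by (auto intro!: mult_right_mono)
      then show "min 1 (s j * y j) \<le> max 1 (s j) * min 1 (y j)"
        by (auto simp: min_def)
    qed
    finally show ?thesis .
  qed
  show ?case
  proof (rule Bochner_Integration.integrable_bound)
    show "integrable N (\<lambda>y. \<Sum>j\<in>I. max 1 (s j) * min 1 (y j))"
      by (intro Bochner_Integration.integrable_sum Bochner_Integration.integrable_mult_right int)
    show "AE y in N. norm (exp (- (\<Sum>j\<in>I. s j * 0)) - exp (- (\<Sum>j\<in>I. s j * y j)))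
        \<le> norm (\<Sum>j\<in>I. max 1 (s j) * min 1 (y j))"
      using pos by eventually_elim (use bd in \<open>fastforce\<close>)
  qed measurable
next
  case (add P Q)
  from Bochner_Integration.integrable_add[OF add.IH] show ?case by (simp add: algebra_simps)
next
  case (scale P c)
  from Bochner_Integration.integrable_mult_right[OF scale.IH, of c] show ?case
      by (simp add: algebra_simps)
qed

lemma integral_exp_span_eq:
  assumes I: "finite I"
    and sets1: "sets N1 = sets (\<Pi>\<^sub>M j\<in>I. borel)" and sets2: "sets N2 = sets (\<Pi>\<^sub>M j\<in>I. borel)"
    and pos1: "AE y in N1. \<forall>j\<in>I. 0 \<le> y j" and pos2: "AE y in N2. \<forall>j\<in>I. 0 \<le> y j"
    and int1: "\<And>j. j \<in> I \<Longrightarrow> integrable N1 (\<lambda>y. min 1 (y j))"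
    and int2: "\<And>j. j \<in> I \<Longrightarrow> integrable N2 (\<lambda>y. min 1 (y j))"
    and eq: "\<And>s. (\<And>j. j \<in> I \<Longrightarrow> 0 \<le> s j) \<Longrightarrow>
      (\<integral>\<^sup>+y. ennreal (1 - exp (- (\<Sum>j\<in>I. s j * y j))) \<partial>N1) =
      (\<integral>\<^sup>+y. ennreal (1 - exp (- (\<Sum>j\<in>I. s j * y j))) \<partial>N2)"
    and P: "P \<in> exp_span I"
  shows "(\<integral>y. P (\<lambda>_. 0) - P y \<partial>N1) = (\<integral>y. P (\<lambda>_. 0) - P y \<partial>N2)"
  using P
proof induction
  case (exp s)
  have "AE y in N. 0 \<le> 1 - exp (- (\<Sum>j\<in>I. s j * y j))"
    if "AE y in N. \<forall>j\<in>I. 0 \<le> y j" for N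
    using that by eventually_elim (use exp in \<open>auto intro!: sum_nonneg\<close>)
  then have "(\<integral>y. 1 - exp (- (\<Sum>j\<in>I. s j * y j)) \<partial>N)
      = enn2real (\<integral>\<^sup>+y. ennreal (1 - exp (- (\<Sum>j\<in>I. s j * y j))) \<partial>N)"
    if "AE y in N. \<forall>j\<in>I. 0 \<le> y j" "sets N = sets (\<Pi>\<^sub>M j\<in>I. borel)" for N
  proof -
    note [measurable_cong] = that(2)
    show ?thesis
      using \<open>\<And>N. (AE y in N. \<forall>j\<in>I. 0 \<le> y j) \<Longrightarrow> AE y in N. 0 \<le> 1 - exp (- (\<Sum>j\<in>I. s j * y j))\<close>[OF that(1)]
      by (intro integral_eq_nn_integral) measurable
  qed
  from this[OF pos1 sets1] this[OF pos2 sets2] eq[of s] exp show ?case by simp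
next
  case (add P Q)
  have "(\<integral>y. (P (\<lambda>_. 0) - P y) + (Q (\<lambda>_. 0) - Q y) \<partial>N1) =
      (\<integral>y. (P (\<lambda>_. 0) - P y) + (Q (\<lambda>_. 0) - Q y) \<partial>N2)"
    using add integrable_exp_span[OF I sets1 pos1 int1] integrable_exp_span[OF I sets2 pos2 int2]
    by simp
  then show ?case by (simp add: algebra_simps)
next
  case (scale P c)
  have "(\<integral>y. c * (P (\<lambda>_. 0) - P y) \<partial>N1) = (\<integral>y. c * (P (\<lambda>_. 0) - P y) \<partial>N2)"
    using scale by simp
  then show ?case by (simp add: algebra_simps)
qed

text \<open>With \<open>m = n + 3\<close>, this is the distribution function of the maximum of \<open>m\<close> independent exponential
  variables of rate \<open>k = ln m + ln (ln m)\<close>. Such a maximum concentrates near \<open>1\<close>, since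
  \<open>m * exp (- k * y) = m powr (1 - y) / ln m powr y\<close> tends to infinity for \<open>y < 1\<close> and to \<open>0\<close>
  for \<open>y \<ge> 1\<close>. The term \<open>ln (ln m)\<close> decides the boundary point \<open>y = 1\<close>; without it the limit
  there would be \<open>exp (- 1)\<close>.
  The shift by \<open>3\<close> ensures \<open>ln m \<ge> 1\<close>, hence a nonnegative rate.\<close>

definition steep :: "nat \<Rightarrow> real \<Rightarrow> real" where
  "steep n y = (1 - exp (- (ln (real (n + 3) * ln (real (n + 3))) * y))) ^ (n + 3)"

lemma steep_rate_nonneg: "0 \<le> ln (real (n + 3) * ln (real (n + 3)))"
proof -
  have "1 \<le> ln (3::real)" using e_less_272 by (subst ln_ge_iff) auto
  also have "\<dots> \<le> ln (real (n + 3))" by simp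
  finally have "1 * 1 \<le> real (n + 3) * ln (real (n + 3))" by (intro mult_mono) auto
  then show ?thesis by simp
qed

lemma steep_nonneg: "0 \<le> y \<Longrightarrow> 0 \<le> steep n y"
  unfolding steep_def using steep_rate_nonneg[of n] by (intro zero_le_power) simp

lemma steep_le_1: "0 \<le> y \<Longrightarrow> steep n y \<le> 1"
  unfolding steep_def using steep_rate_nonneg[of n] by (intro power_le_one) auto

lemma steep_tendsto:
  assumes "0 \<le> y"
  shows "(\<lambda>n. steep n y) \<longlonglongrightarrow> (if 1 \<le> y then 1 else 0)"
proof -
  consider "y = 0" | "0 < y" "y < 1" | "y = 1" | "1 < y" using assms by linarith
  then show ?thesis
  proof cases
    case 1
    then show ?thesis by (simp add: steep_def numeral_3_eq_3)
  next
    case 2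
    have "(\<lambda>n. steep n y) \<longlonglongrightarrow> 0" unfolding steep_def using 2 by real_asymp
    then show ?thesis using 2 by simp
  next
    case 3
    have "(\<lambda>n. steep n 1) \<longlonglongrightarrow> 1" unfolding steep_def by real_asymp
    then show ?thesis using 3 by simp
  next
    case 4
    have "(\<lambda>n. steep n y) \<longlonglongrightarrow> 1" unfolding steep_def using 4 by real_asymp
    then show ?thesis using 4 by simp
  qed
qed

text \<open>The majorant needed for dominated convergence. Only small \<open>y\<close> matter: there one factor of the power
  gives the linear decay \<open>k * y\<close>, and the remaining ones are so small, uniformly in \<open>y < 1 / 2\<close>, that
  they outweigh the growing rate \<open>k\<close>.\<close>

lemma steep_bound: "\<exists>C\<ge>0. \<forall>n y. 0 \<le> y \<longrightarrow> steep n y \<le> C * min 1 y"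
proof -
  define k where "k n = ln (real (n + 3) * ln (real (n + 3)))" for n
  define B where "B n = k n * exp (- (real (n + 2) * exp (- (k n / 2))))" for n
  have "B \<longlonglongrightarrow> 0" unfolding B_def k_def by real_asymp
  then have "Bseq B" by (intro convergent_imp_Bseq convergentI)
  then obtain K where K: "0 < K" "\<And>n. norm (B n) \<le> K" unfolding Bseq_def by auto
  have "steep n y \<le> max 2 K * min 1 y" if y: "0 \<le> y" for n y
  proof (cases "1 / 2 \<le> y")
    case True
    have "steep n y \<le> 1" by (rule steep_le_1[OF y])
    also have "1 \<le> max 2 K * min 1 y"
    proof -
      have "2 * (1 / 2) \<le> max 2 K * min 1 y" using True by (intro mult_mono) auto
      then show ?thesis by simp
    qed
    finally show ?thesis .
  next
    case False
    have k: "0 \<le> k n" unfolding k_def by (rule steep_rate_nonneg)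
    let ?e = "exp (- (k n * y))"
    have e: "?e \<le> 1" using k y by simp
    have a: "1 - ?e \<le> k n * y" using exp_ge_add_one_self[of "- (k n * y)"] by simp
    have "exp (- (k n / 2)) \<le> ?e" using mult_left_mono[of y "1 / 2" "k n"] k False by simp
    then have "1 - ?e \<le> exp (- exp (- (k n / 2)))"
      using exp_ge_add_one_self[of "- exp (- (k n / 2))"] by linarith
    then have "(1 - ?e) ^ (n + 2) \<le> exp (- exp (- (k n / 2))) ^ (n + 2)"
      using e by (intro power_mono) auto
    also have "\<dots> = exp (- (real (n + 2) * exp (- (k n / 2))))"
      by (subst exp_of_nat_mult[symmetric]) simp
    finally have b: "(1 - ?e) ^ (n + 2) \<le> exp (- (real (n + 2) * exp (- (k n / 2))))" .
    have "steep n y = (1 - ?e) * (1 - ?e) ^ (n + 2)"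
      unfolding steep_def k_def by (simp add: numeral_3_eq_3)
    also have "\<dots> \<le> (k n * y) * exp (- (real (n + 2) * exp (- (k n / 2))))"
      using a b e k y by (intro mult_mono) auto
    also have "\<dots> = B n * y" by (simp add: B_def)
    also have "\<dots> \<le> max 2 K * y"
      using K(2)[of n] y by (intro mult_right_mono) auto
    finally show ?thesis using False by (simp add: min_def)
  qed
  then show ?thesis by (intro exI[of _ "max 2 K"]) auto
qed

lemma one_minus_prod_le_sum:
  fixes q :: "'i \<Rightarrow> real"
  assumes "\<And>j. j \<in> I \<Longrightarrow> 0 \<le> q j \<and> q j \<le> 1"
  shows "1 - (\<Prod>j\<in>I. 1 - q j) \<le> (\<Sum>j\<in>I. q j)"
  using Weierstrass_prod_ineq[of I q] assms by force

text \<open>The product of \<open>1 - steep n (a j * y j)\<close> over \<open>j\<close> is a combination of Laplace kernels with value \<open>1\<close>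
  at the origin, and on the orthant it converges to the indicator of the box \<open>{y. \<forall>j. a j * y j < 1}\<close>.\<close>

lemma emeasure_eq_of_Laplace:
  fixes N1 N2 :: "('i \<Rightarrow> real) measure"
  assumes I: "finite I"
    and sets1: "sets N1 = sets (\<Pi>\<^sub>M j\<in>I. borel)" and sets2: "sets N2 = sets (\<Pi>\<^sub>M j\<in>I. borel)"
    and pos1: "AE y in N1. \<forall>j\<in>I. 0 \<le> y j" and pos2: "AE y in N2. \<forall>j\<in>I. 0 \<le> y j"
    and int1: "\<And>j. j \<in> I \<Longrightarrow> integrable N1 (\<lambda>y. min 1 (y j))"
    and int2: "\<And>j. j \<in> I \<Longrightarrow> integrable N2 (\<lambda>y. min 1 (y j))"
    and eq: "\<And>s. (\<And>j. j \<in> I \<Longrightarrow> 0 \<le> s j) \<Longrightarrow>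
      (\<integral>\<^sup>+y. ennreal (1 - exp (- (\<Sum>j\<in>I. s j * y j))) \<partial>N1) =
      (\<integral>\<^sup>+y. ennreal (1 - exp (- (\<Sum>j\<in>I. s j * y j))) \<partial>N2)"
    and a: "\<And>j. j \<in> I \<Longrightarrow> 0 \<le> a j"
  shows "emeasure N1 {y \<in> space N1. \<exists>j\<in>I. 1 \<le> a j * y j} =
    emeasure N2 {y \<in> space N2. \<exists>j\<in>I. 1 \<le> a j * y j}"
proof -
  define Q where "Q n y = (\<Prod>j\<in>I. 1 - steep n (a j * y j))" for n and y :: "'i \<Rightarrow> real"
  have Q_span: "Q n \<in> exp_span I" for n
  proof -
    have "(\<lambda>y. \<Prod>j\<in>I. 1 - (1 - exp (- ((ln (real (n + 3) * ln (real (n + 3))) * a j) * y j))) ^ (n +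
        3)) \<in> exp_span I"
      using steep_rate_nonneg[of n] I a
      by (intro exp_span_prod exp_span_diff exp_span_power exp_span_const exp_span_exp_single) auto
    then show ?thesis by (simp add: Q_def[abs_def] steep_def mult.assoc)
  qed
  have Q0: "Q n (\<lambda>_. 0) = 1" for n by (simp add: Q_def steep_def numeral_3_eq_3)
  obtain C where C: "0 \<le> C" "\<And>n y. 0 \<le> y \<Longrightarrow> steep n y \<le> C * min 1 y"
    using steep_bound by blast
  \<comment> \<open>The factor \<open>max 1 (a j)\<close> makes it possible to replace \<open>min 1 (a j * y j)\<close>
      by the integrable \<open>min 1 (y j)\<close>.\<close>
  let ?w = "\<lambda>y. \<Sum>j\<in>I. C * (max 1 (a j) * min 1 (y j))"
  let ?ind = "\<lambda>y. indicator {y. \<exists>j\<in>I. 1 \<le> a j * y j} y :: real"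
  have lim: "(\<lambda>n. 1 - Q n y) \<longlonglongrightarrow> ?ind y" if y: "\<forall>j\<in>I. 0 \<le> y j" for y
  proof -
    have "(\<lambda>n. 1 - Q n y) \<longlonglongrightarrow> 1 - (\<Prod>j\<in>I. 1 - (if 1 \<le> a j * y j then 1 else 0))"
      unfolding Q_def using a y by (intro tendsto_intros steep_tendsto) auto
    also have "1 - (\<Prod>j\<in>I. 1 - (if 1 \<le> a j * y j then 1 else 0)) = ?ind y"
    proof (cases "\<exists>j\<in>I. 1 \<le> a j * y j")
      case True
      then have "(\<Prod>j\<in>I. 1 - (if 1 \<le> a j * y j then 1 else (0::real))) = 0"
        using I by (subst prod_zero_iff) auto
      then show ?thesis using True by simp
    next
      case False
      then have "(\<Prod>j\<in>I. 1 - (if 1 \<le> a j * y j then 1 else (0::real))) = 1"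
        by (intro prod.neutral) auto
      then show ?thesis using False by simp
    qed
    finally show ?thesis .
  qed
  have bd: "norm (1 - Q n y) \<le> ?w y" if y: "\<forall>j\<in>I. 0 \<le> y j" for n y
  proof -
    have st: "0 \<le> steep n (a j * y j) \<and> steep n (a j * y j) \<le> 1" if "j \<in> I" for j
      using a y that by (auto intro!: steep_nonneg steep_le_1)
    have "Q n y \<le> 1" unfolding Q_def using st by (intro prod_le_1) auto
    then have "norm (1 - Q n y) = 1 - Q n y" by simp
    also have "\<dots> \<le> (\<Sum>j\<in>I. steep n (a j * y j))"
      unfolding Q_def by (rule one_minus_prod_le_sum) (rule st)
    also have "\<dots> \<le> ?w y"
    proof (rule sum_mono)
      fix j assume j: "j \<in> I"
      have "steep n (a j * y j) \<le> C * min 1 (a j * y j)"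
        using a j y by (intro C) auto
      also have "a j * y j \<le> max 1 (a j) * y j" using j y by (auto intro!: mult_right_mono)
      then have "min 1 (a j * y j) \<le> max 1 (a j) * min 1 (y j)" by (auto simp: min_def)
      then have "C * min 1 (a j * y j) \<le> C * (max 1 (a j) * min 1 (y j))"
        using C by (intro mult_left_mono)
      finally show "steep n (a j * y j) \<le> C * (max 1 (a j) * min 1 (y j))" .
    qed
    finally show ?thesis .
  qed
  have main: "(\<lambda>n. \<integral>y. 1 - Q n y \<partial>N) \<longlonglongrightarrow> (\<integral>y. ?ind y \<partial>N)"
    "emeasure N {y \<in> space N. \<exists>j\<in>I. 1 \<le> a j * y j} = ennreal (\<integral>y. ?ind y \<partial>N)"
    if sets: "sets N = sets (\<Pi>\<^sub>M j\<in>I. borel)" and pos: "AE y in N. \<forall>j\<in>I. 0 \<le> y j"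
      and int: "\<And>j. j \<in> I \<Longrightarrow> integrable N (\<lambda>y. min 1 (y j))" for N :: "('i \<Rightarrow> real) measure"
  proof -
    note [measurable_cong] = sets
    have w: "integrable N ?w"
      by (intro Bochner_Integration.integrable_sum Bochner_Integration.integrable_mult_right int)
    have K[measurable]: "{y \<in> space N. \<exists>j\<in>I. 1 \<le> a j * y j} \<in> sets N"
      using I by measurable
    have ind_m: "?ind \<in> borel_measurable N"
    proof -
      have "(indicator {y \<in> space N. \<exists>j\<in>I. 1 \<le> a j * y j} :: _ \<Rightarrow> real) \<in> borel_measurable N"
          by measurable
      then show ?thesis by (rule measurable_cong[THEN iffD1, rotated]) (auto simp: indicator_def)
    qed
    have Q_m: "(\<lambda>y. 1 - Q n y) \<in> borel_measurable N" for n
      unfolding Q_def steep_def by measurable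
    have AE_lim: "AE y in N. (\<lambda>n. 1 - Q n y) \<longlonglongrightarrow> ?ind y"
      using pos by eventually_elim (rule lim)
    have AE_bd: "AE y in N. norm (1 - Q n y) \<le> ?w y" for n
      using pos by eventually_elim (rule bd)
    show "(\<lambda>n. \<integral>y. 1 - Q n y \<partial>N) \<longlonglongrightarrow> (\<integral>y. ?ind y \<partial>N)"
      by (rule integral_dominated_convergence[OF ind_m Q_m w AE_lim AE_bd])
    have "integrable N ?ind"
      by (rule integrable_dominated_convergence[OF ind_m Q_m w AE_lim AE_bd])
    then have "(\<integral>\<^sup>+y. ennreal (?ind y) \<partial>N) = ennreal (\<integral>y. ?ind y \<partial>N)"
      by (rule nn_integral_eq_integral) simp
    moreover have "(\<integral>\<^sup>+y. ennreal (?ind y) \<partial>N) =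
        (\<integral>\<^sup>+y. indicator {y \<in> space N. \<exists>j\<in>I. 1 \<le> a j * y j} y \<partial>N)"
      by (rule nn_integral_cong) (auto simp: indicator_def)
    ultimately show "emeasure N {y \<in> space N. \<exists>j\<in>I. 1 \<le> a j * y j} = ennreal (\<integral>y. ?ind y \<partial>N)"
      by (simp only: nn_integral_indicator[OF K])
  qed
  have "(\<integral>y. 1 - Q n y \<partial>N1) = (\<integral>y. 1 - Q n y \<partial>N2)" for n
    using integral_exp_span_eq[OF I sets1 sets2 pos1 pos2 int1 int2 eq Q_span[of n]] by (simp add: Q0)
  with main(1)[OF sets1 pos1 int1] have "(\<lambda>n. \<integral>y. 1 - Q n y \<partial>N2) \<longlonglongrightarrow> (\<integral>y. ?ind y \<partial>N1)"
    by simp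
  with main(1)[OF sets2 pos2 int2] have "(\<integral>y. ?ind y \<partial>N1) = (\<integral>y. ?ind y \<partial>N2)"
    by (rule LIMSEQ_unique[rotated])
  then show ?thesis
    by (simp only: main(2)[OF sets1 pos1 int1] main(2)[OF sets2 pos2 int2])
qed

section \<open>Gaussian averages of linear forms\<close>

definition gauss :: "real measure" where
  "gauss = density lborel std_normal_density"

lemma prob_space_gauss: "prob_space gauss"
  unfolding gauss_def by (rule prob_space_normal_density) simp

lemma sets_gauss [simp, measurable_cong]: "sets gauss = sets borel"
  by (simp add: gauss_def)

lemma space_gauss [simp]: "space gauss = UNIV"
  by (simp add: gauss_def)

text \<open>Together with positivity of the moment, this makes it possible to cancel the constant that Gaussian averaging
  produces.\<close>

lemma gauss_moment_finite:
  assumes "0 < \<alpha>" "\<alpha> < 2"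
  shows "(\<integral>\<^sup>+z. ennreal (\<bar>z\<bar> powr \<alpha>) \<partial>gauss) < \<infinity>"
proof -
  have le: "\<bar>z\<bar> powr \<alpha> \<le> 1 + \<bar>z\<bar> ^ 2" for z :: real
  proof (cases "\<bar>z\<bar> \<le> 1")
    case True
    then have "\<bar>z\<bar> powr \<alpha> \<le> 1" using assms by (intro powr_le1) auto
    then show ?thesis by (simp add: add_increasing2)
  next
    case False
    then have "\<bar>z\<bar> powr \<alpha> \<le> \<bar>z\<bar> powr 2" using assms by (intro powr_mono) auto
    also have "\<bar>z\<bar> powr 2 = \<bar>z\<bar> ^ 2" using False by (simp add: powr_numeral)
    finally show ?thesis by simp
  qed
  have "integrable gauss (\<lambda>z. 1 + \<bar>z\<bar> ^ 2)"
    unfolding gauss_def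
    by (subst integrable_real_density)
       (auto simp: ring_distribs
           intro!: Bochner_Integration.integrable_add integrable_std_normal_moment_abs[of 2, simplified])
  then have "(\<integral>\<^sup>+z. ennreal (1 + \<bar>z\<bar> ^ 2) \<partial>gauss) < \<infinity>"
    by (subst nn_integral_eq_integral) auto
  moreover have "(\<integral>\<^sup>+z. ennreal (\<bar>z\<bar> powr \<alpha>) \<partial>gauss) \<le> (\<integral>\<^sup>+z. ennreal (1 + \<bar>z\<bar> ^ 2) \<partial>gauss)"
    by (intro nn_integral_mono ennreal_leI le)
  ultimately show ?thesis by (rule le_less_trans[rotated])
qed

lemma gauss_moment_nonzero: "(\<integral>\<^sup>+z. ennreal (\<bar>z\<bar> powr \<alpha>) \<partial>gauss) \<noteq> 0"
proof
  assume "(\<integral>\<^sup>+z. ennreal (\<bar>z\<bar> powr \<alpha>) \<partial>gauss) = 0"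
  then have "AE z in gauss. ennreal (\<bar>z\<bar> powr \<alpha>) = 0"
    by (subst (asm) nn_integral_0_iff_AE) auto
  then have "AE z in lborel. 0 < std_normal_density z \<longrightarrow> z = 0"
    unfolding gauss_def by (subst (asm) AE_density) (auto simp: ennreal_eq_0_iff)
  then have "AE z in lborel. z = (0::real)"
    by eventually_elim (simp add: normal_density_pos)
  then have "emeasure lborel {z::real. z \<noteq> 0} = 0"
    by (subst (asm) AE_iff_measurable[OF _ refl]) auto
  \<comment> \<open>Any interval that misses \<open>0\<close> and has positive length gives the contradiction.\<close>
  moreover have "emeasure lborel {1..2::real} \<le> emeasure lborel {z::real. z \<noteq> 0}"
    by (intro emeasure_mono) auto
  ultimately show False by simp
qed

text \<open>A linear form of independent standard normal variables is distributed like \<open>\<sigma> * z\<close> with \<open>\<sigma>\<close> the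
  Euclidean norm of the coefficients and \<open>z\<close> standard normal. Vanishing coefficients are dropped first,
  as a degenerate summand has no density.\<close>

lemma gauss_linear_moment:
  fixes x :: "'i \<Rightarrow> real"
  assumes I: "finite I" and \<alpha>: "0 < \<alpha>"
  shows "(\<integral>\<^sup>+w. ennreal (\<bar>\<Sum>j\<in>I. w j * x j\<bar> powr \<alpha>) \<partial>(\<Pi>\<^sub>M j\<in>I. gauss)) =
    ennreal ((\<Sum>j\<in>I. (x j)\<^sup>2) powr (\<alpha> / 2)) * (\<integral>\<^sup>+z. ennreal (\<bar>z\<bar> powr \<alpha>) \<partial>gauss)"
proof -
  define J where "J = {j \<in> I. x j \<noteq> 0}"
  have J: "finite J" "J \<subseteq> I" using I by (auto simp: J_def)
  have sum_J: "(\<Sum>j\<in>I. w j * x j) = (\<Sum>j\<in>J. x j * w j)" for w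
    using I by (intro sum.mono_neutral_cong_right) (auto simp: J_def)
  have sq_J: "(\<Sum>j\<in>I. (x j)\<^sup>2) = (\<Sum>j\<in>J. \<bar>x j\<bar>\<^sup>2)"
    using I by (intro sum.mono_neutral_cong_right) (auto simp: J_def)
  interpret G: prob_space gauss by (rule prob_space_gauss)
  interpret N: prob_space "\<Pi>\<^sub>M j\<in>I. gauss" by (rule prob_space_PiM) (rule prob_space_gauss)
  show ?thesis
  proof (cases "J = {}")
    case True
    then show ?thesis unfolding sum_J sq_J using \<alpha> by simp
  next
    case False
    define \<sigma> where "\<sigma> = sqrt (\<Sum>j\<in>J. \<bar>x j\<bar>\<^sup>2)"
    have pos: "0 < (\<Sum>j\<in>J. \<bar>x j\<bar>\<^sup>2)"
      using J False by (intro sum_pos) (auto simp: J_def)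
    then have \<sigma>: "0 < \<sigma>" by (simp add: \<sigma>_def)
    have coord: "distr (\<Pi>\<^sub>M j\<in>I. gauss) borel (\<lambda>w. w j) = gauss" if "j \<in> I" for j
    proof -
      have "distr (\<Pi>\<^sub>M j\<in>I. gauss) borel (\<lambda>w. w j) = distr (\<Pi>\<^sub>M j\<in>I. gauss) gauss (\<lambda>w. w j)"
        by (rule distr_cong) auto
      also have "\<dots> = gauss" using that by (intro distr_PiM_component prob_space_gauss)
      finally show ?thesis .
    qed
    have "N.indep_vars (\<lambda>_. borel) (\<lambda>j w. w j) I"
    proof (subst N.indep_vars_iff_distr_eq_PiM')
      show "I \<noteq> {}" using False J by auto
      have "distr (\<Pi>\<^sub>M j\<in>I. gauss) (\<Pi>\<^sub>M j\<in>I. borel) (\<lambda>w. \<lambda>j\<in>I. w j) =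
          distr (\<Pi>\<^sub>M j\<in>I. gauss) (\<Pi>\<^sub>M j\<in>I. gauss) (\<lambda>w. w)"
        by (rule distr_cong) (auto simp: space_PiM PiE_def extensional_restrict intro!: sets_PiM_cong)
      also have "\<dots> = (\<Pi>\<^sub>M j\<in>I. gauss)" by simp
      also have "\<dots> = (\<Pi>\<^sub>M j\<in>I. distr (\<Pi>\<^sub>M j\<in>I. gauss) borel (\<lambda>w. w j))"
        by (rule PiM_cong) (auto simp: coord)
      finally show "distr (\<Pi>\<^sub>M j\<in>I. gauss) (\<Pi>\<^sub>M j\<in>I. borel) (\<lambda>w. \<lambda>j\<in>I. w j) =
        (\<Pi>\<^sub>M j\<in>I. distr (\<Pi>\<^sub>M j\<in>I. gauss) borel (\<lambda>w. w j))" .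
    qed auto
    then have "N.indep_vars (\<lambda>_. borel) (\<lambda>j w. w j) J"
      by (rule N.indep_vars_subset) (rule J(2))
    then have indep: "N.indep_vars (\<lambda>_. borel) (\<lambda>j w. x j * w j) J"
      by (rule N.indep_vars_compose2) auto
    have normal: "distributed (\<Pi>\<^sub>M j\<in>I. gauss) lborel (\<lambda>w. x j * w j) (normal_density 0 \<bar>x j\<bar>)"
        if "j \<in> J" for j
    proof -
      have j: "j \<in> I" "x j \<noteq> 0" using that by (auto simp: J_def)
      have "distr (\<Pi>\<^sub>M j\<in>I. gauss) lborel (\<lambda>w. w j) = distr (\<Pi>\<^sub>M j\<in>I. gauss) borel (\<lambda>w. w j)"
        by (rule distr_cong) auto
      then have "distributed (\<Pi>\<^sub>M j\<in>I. gauss) lborel (\<lambda>w. w j) std_normal_density"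
        unfolding distributed_def using j(1) by (auto simp: coord gauss_def[symmetric])
      from N.normal_density_affine[OF this _ j(2), of 0] show ?thesis by simp
    qed
    have "distributed (\<Pi>\<^sub>M j\<in>I. gauss) lborel (\<lambda>w. \<Sum>j\<in>J. x j * w j) (normal_density (\<Sum>j\<in>J. 0) \<sigma>)"
      unfolding \<sigma>_def
      by (rule N.sum_indep_normal[OF J(1) False indep _ normal]) (auto simp: J_def)
    then have *: "distributed (\<Pi>\<^sub>M j\<in>I. gauss) lborel (\<lambda>w. \<Sum>j\<in>J. x j * w j) (normal_density 0 \<sigma>)"
      by simp
    have "distributed gauss lborel (\<lambda>z. z) std_normal_density"
    proof -
      have "distr gauss lborel (\<lambda>z. z) = gauss" by (rule distr_id2) simp
      then show ?thesis by (simp add: distributed_def flip: gauss_def)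
    qed
    from G.normal_density_affine[OF this, of \<sigma> 0] \<sigma>
    have **: "distributed gauss lborel (\<lambda>z. \<sigma> * z) (normal_density 0 \<sigma>)" by simp
    have "(\<integral>\<^sup>+w. ennreal (\<bar>\<Sum>j\<in>I. w j * x j\<bar> powr \<alpha>) \<partial>(\<Pi>\<^sub>M j\<in>I. gauss))
        = (\<integral>\<^sup>+z. ennreal (\<bar>\<sigma> * z\<bar> powr \<alpha>) \<partial>gauss)"
      unfolding sum_J
      using distributed_nn_integral[OF *, of "\<lambda>z. ennreal (\<bar>z\<bar> powr \<alpha>)"]
        distributed_nn_integral[OF **, of "\<lambda>z. ennreal (\<bar>z\<bar> powr \<alpha>)"] by simp
    also have "\<dots> = (\<integral>\<^sup>+z. ennreal (\<sigma> powr \<alpha>) * ennreal (\<bar>z\<bar> powr \<alpha>) \<partial>gauss)"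
      using \<sigma> by (simp add: abs_mult powr_mult ennreal_mult)
    also have "\<dots> = ennreal (\<sigma> powr \<alpha>) * (\<integral>\<^sup>+z. ennreal (\<bar>z\<bar> powr \<alpha>) \<partial>gauss)"
      by (rule nn_integral_cmult) measurable
    also have "\<sigma> powr \<alpha> = (\<Sum>j\<in>I. (x j)\<^sup>2) powr (\<alpha> / 2)"
      unfolding \<sigma>_def sq_J using pos by (simp add: powr_half_sqrt[symmetric] powr_powr)
    finally show ?thesis .
  qed
qed

section \<open>From maxima to sums\<close>

lemma emeasure_ray_measure_tail:
  assumes I: "finite I" "I \<noteq> {}" and g: "\<And>j. j \<in> I \<Longrightarrow> g j \<in> borel_measurable M" and "0 < \<beta>"
    and pos: "\<And>j x. j \<in> I \<Longrightarrow> 0 \<le> g j x" and a: "\<And>j. j \<in> I \<Longrightarrow> 0 \<le> a j"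
  shows "emeasure (ray_measure \<beta> I M g) {y \<in> space (ray_measure \<beta> I M g). \<exists>j\<in>I. 1 \<le> a j * y j} =
    (\<integral>\<^sup>+x. ennreal ((MAX j\<in>I. a j * g j x) powr \<beta>) \<partial>M)"
proof -
  have "{y \<in> space (ray_measure \<beta> I M g). \<exists>j\<in>I. 1 \<le> a j * y j}
      = {y \<in> space (\<Pi>\<^sub>M j\<in>I. borel). 1 \<le> (MAX j\<in>I. a j * y j)}"
    using I by (simp add: Max_ge_iff space_ray_measure space_PiM)
  also have "emeasure (ray_measure \<beta> I M g) \<dots>
      = (\<integral>\<^sup>+x. ennreal ((MAX j\<in>I. a j * (\<lambda>j\<in>I. g j x) j) powr \<beta>) \<partial>M)"
  proof (rule emeasure_ray_measure_atLeast_1[OF g \<open>0 < \<beta>\<close>])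
    show "(\<lambda>y. MAX j\<in>I. a j * y j) \<in> borel_measurable (\<Pi>\<^sub>M j\<in>I. borel)"
      using I(1) by (rule borel_measurable_Max) measurable
    show "(MAX j\<in>I. a j * (\<lambda>j\<in>I. r * g j x) j) = r * (MAX j\<in>I. a j * (\<lambda>j\<in>I. g j x) j)"
      if "0 \<le> r" for r x
      using MAX_mult_left[OF I that, of "\<lambda>j. a j * g j x"] by (simp add: mult.left_commute)
    show "0 \<le> (MAX j\<in>I. a j * (\<lambda>j\<in>I. g j x) j)" for x
      using I a pos by (auto simp: Max_ge_iff)
  qed
  finally show ?thesis by simp
qed

lemma emeasure_ray_measure_outside_box:
  assumes I: "finite I" "I \<noteq> {}" and f: "\<And>j. j \<in> I \<Longrightarrow> f j \<in> borel_measurable M" and \<alpha>: "0 < \<alpha>"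
    and pos: "\<And>j x. j \<in> I \<Longrightarrow> 0 \<le> f j x" and b: "\<And>j. j \<in> I \<Longrightarrow> 0 < b j"
  shows "emeasure (ray_measure \<alpha> I M f) {y \<in> space (ray_measure \<alpha> I M f). \<exists>j\<in>I. b j \<le> y j} =
    (\<integral>\<^sup>+x. ennreal ((MAX j\<in>I. (1 / b j) * f j x) powr \<alpha>) \<partial>M)"
proof -
  have "(b j \<le> t) = (1 \<le> (1 / b j) * t)" if "j \<in> I" for j t
    using b[OF that] by (simp add: field_simps)
  then have "{y \<in> space (ray_measure \<alpha> I M f). \<exists>j\<in>I. b j \<le> y j}
      = {y \<in> space (ray_measure \<alpha> I M f). \<exists>j\<in>I. 1 \<le> (1 / b j) * y j}"
    by (auto cong: bex_cong)
  also have "emeasure (ray_measure \<alpha> I M f) \<dots> = (\<integral>\<^sup>+x. ennreal ((MAX j\<in>I. (1 / b j) * f j x) powr \<alpha>) \<partial>M)"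
    using f pos b by (intro emeasure_ray_measure_tail I \<alpha>) (auto simp: less_imp_le)
  finally show ?thesis .
qed

lemma emeasure_ray_measure_linear:
  assumes \<alpha>: "0 < \<alpha>" and f: "\<And>j. j \<in> I \<Longrightarrow> f j \<in> borel_measurable M"
  shows "emeasure (ray_measure \<alpha> I M f) {y \<in> space (\<Pi>\<^sub>M j\<in>I. borel). 1 \<le> \<bar>\<Sum>j\<in>I. a j * y j\<bar>} =
    (\<integral>\<^sup>+x. ennreal (\<bar>\<Sum>j\<in>I. a j * f j x\<bar> powr \<alpha>) \<partial>M)"
  (is "emeasure _ ?A = _")
proof -
  have "emeasure (ray_measure \<alpha> I M f) ?A = (\<integral>\<^sup>+x. ennreal (\<bar>\<Sum>j\<in>I. a j * (\<lambda>j\<in>I. f j x) j\<bar> powr \<alpha>) \<partial>M)"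
  proof (rule emeasure_ray_measure_atLeast_1[OF f \<alpha>])
    show "\<bar>\<Sum>j\<in>I. a j * (\<lambda>j\<in>I. r * f j x) j\<bar> = r * \<bar>\<Sum>j\<in>I. a j * (\<lambda>j\<in>I. f j x) j\<bar>" if "0 \<le> r" for r x
      using that by (simp add: mult.left_commute abs_mult flip: sum_distrib_left)
  qed auto
  then show ?thesis by simp
qed

text \<open>The region \<open>{y. 1 \<le> \<bar>\<Sum>j. a j * y j\<bar>}\<close> avoids a cube around the origin, so complements of boxes
  determine its mass.\<close>

lemma max_functional_imp_sum_functional:
  fixes f1 :: "'i \<Rightarrow> 'a \<Rightarrow> real" and f2 :: "'i \<Rightarrow> 'b \<Rightarrow> real"
  assumes I: "finite I" "I \<noteq> {}" and \<alpha>: "0 < \<alpha>"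
    and f1: "\<And>j. j \<in> I \<Longrightarrow> f1 j \<in> borel_measurable M1" "\<And>j x. j \<in> I \<Longrightarrow> 0 \<le> f1 j x"
    and f2: "\<And>j. j \<in> I \<Longrightarrow> f2 j \<in> borel_measurable M2" "\<And>j x. j \<in> I \<Longrightarrow> 0 \<le> f2 j x"
    and fin: "\<And>b. (\<And>j. j \<in> I \<Longrightarrow> 0 \<le> b j) \<Longrightarrow> (\<integral>\<^sup>+x. ennreal ((MAX j\<in>I. b j * f1 j x) powr \<alpha>) \<partial>M1) < \<infinity>"
    and eq: "\<And>b. (\<And>j. j \<in> I \<Longrightarrow> 0 \<le> b j) \<Longrightarrow>
      (\<integral>\<^sup>+x. ennreal ((MAX j\<in>I. b j * f1 j x) powr \<alpha>) \<partial>M1) =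
      (\<integral>\<^sup>+x. ennreal ((MAX j\<in>I. b j * f2 j x) powr \<alpha>) \<partial>M2)"
  shows "(\<integral>\<^sup>+x. ennreal (\<bar>\<Sum>j\<in>I. a j * f1 j x\<bar> powr \<alpha>) \<partial>M1) =
    (\<integral>\<^sup>+x. ennreal (\<bar>\<Sum>j\<in>I. a j * f2 j x\<bar> powr \<alpha>) \<partial>M2)"
proof -
  let ?P = "\<Pi>\<^sub>M j\<in>I. borel :: real measure"
  let ?A = "{y \<in> space ?P. 1 \<le> \<bar>\<Sum>j\<in>I. a j * y j\<bar>}"
  \<comment> \<open>On the cube \<open>{y. \<forall>j. \<bar>y j\<bar> \<le> c}\<close> the linear form stays below \<open>1\<close>.\<close>
  define c where "c = 1 / (1 + (\<Sum>j\<in>I. \<bar>a j\<bar>))"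
  have S: "0 \<le> (\<Sum>j\<in>I. \<bar>a j\<bar>)" by (rule sum_nonneg) simp
  have "emeasure (ray_measure \<alpha> I M1 f1) ?A = emeasure (ray_measure \<alpha> I M2 f2) ?A"
  proof (rule emeasure_eq_of_upper_tails[where c=c])
    show "AE y in ray_measure \<alpha> I M1 f1. \<forall>j\<in>I. 0 \<le> y j" "AE y in ray_measure \<alpha> I M2 f2. \<forall>j\<in>I. 0 \<le> y j"
      by (rule AE_ray_measure_nonneg[OF f1(1) I(1) f1(2)]
          AE_ray_measure_nonneg[OF f2(1) I(1) f2(2)]; assumption)+
    fix b :: "'i \<Rightarrow> real" assume b: "\<And>j. j \<in> I \<Longrightarrow> 0 < b j"
    show "emeasure (ray_measure \<alpha> I M1 f1) {y \<in> space (ray_measure \<alpha> I M1 f1). \<exists>j\<in>I. b j \<le> y j} =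
        emeasure (ray_measure \<alpha> I M2 f2) {y \<in> space (ray_measure \<alpha> I M2 f2). \<exists>j\<in>I. b j \<le> y j}"
      by (simp only: emeasure_ray_measure_outside_box[where f=f1 and M=M1 and b=b, OF I f1(1) \<alpha> f1(2) b]
          emeasure_ray_measure_outside_box[where f=f2 and M=M2 and b=b, OF I f2(1) \<alpha> f2(2) b])
              (rule eq, simp add: b less_imp_le)
    show "emeasure (ray_measure \<alpha> I M1 f1) {y \<in> space (ray_measure \<alpha> I M1 f1). \<exists>j\<in>I. b j \<le> y j} < \<infinity>"
      by (simp only: emeasure_ray_measure_outside_box[where f=f1 and M=M1 and b=b, OF I f1(1) \<alpha>
          f1(2) b]) (rule fin, simp add: b less_imp_le)
  next
    show "0 < c" using S by (simp add: c_def add_pos_nonneg)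
    fix y assume y: "y \<in> ?A" "\<forall>j\<in>I. 0 \<le> y j"
    show "\<exists>j\<in>I. c \<le> y j"
    proof (rule ccontr)
      assume "\<not> ?thesis"
      then have "\<bar>y j\<bar> \<le> c" if "j \<in> I" for j using y that by force
      then have "\<bar>\<Sum>j\<in>I. a j * y j\<bar> \<le> (\<Sum>j\<in>I. \<bar>a j\<bar> * c)"
        by (intro order_trans[OF sum_abs] sum_mono) (auto simp: abs_mult intro!: mult_left_mono)
      also have "\<dots> < 1" using S by (simp add: c_def pos_divide_less_eq add_pos_nonneg
          flip: sum_distrib_right sum_divide_distrib)
      finally show False using y by simp
    qed
  qed (use I in auto)
  then show ?thesis by (simp only: emeasure_ray_measure_linear[where f=f1 and M=M1, OF \<alpha> f1(1)]
      emeasure_ray_measure_linear[where f=f2 and M=M2, OF \<alpha> f2(1)])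
qed

section \<open>From sums to maxima\<close>

text \<open>Tonelli's theorem applied to the Gaussian moment formula; on the right only sum-functionals with
  coefficients \<open>w j * sqrt (s j)\<close> appear.\<close>

lemma gauss_average:
  assumes I: "finite I" and \<alpha>: "0 < \<alpha>"
    and f: "\<And>j. j \<in> I \<Longrightarrow> f j \<in> borel_measurable M" and M: "sigma_finite_measure M"
    and s: "\<And>j. j \<in> I \<Longrightarrow> 0 \<le> s j"
  shows "(\<integral>\<^sup>+x. ennreal ((\<Sum>j\<in>I. s j * (f j x)\<^sup>2) powr (\<alpha> / 2)) \<partial>M) * (\<integral>\<^sup>+z. ennreal (\<bar>z\<bar> powr \<alpha>)
      \<partial>gauss) =
    (\<integral>\<^sup>+w. (\<integral>\<^sup>+x. ennreal (\<bar>\<Sum>j\<in>I. (w j * sqrt (s j)) * f j x\<bar> powr \<alpha>) \<partial>M) \<partial>(\<Pi>\<^sub>M j\<in>I. gauss))"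
  (is "_ * ?c = (\<integral>\<^sup>+w. _ \<partial>?G)")
proof -
  interpret M: sigma_finite_measure M by fact
  interpret G: prob_space ?G by (rule prob_space_PiM) (rule prob_space_gauss)
  interpret pair_sigma_finite ?G M ..
  have meas: "(\<lambda>(w, x). ennreal (\<bar>\<Sum>j\<in>I. (w j * sqrt (s j)) * f j x\<bar> powr \<alpha>)) \<in> borel_measurable (?G
      \<Otimes>\<^sub>M M)"
  proof -
    have "(\<lambda>p. \<Sum>j\<in>I. (fst p j * sqrt (s j)) * f j (snd p)) \<in> borel_measurable (?G \<Otimes>\<^sub>M M)"
    proof (rule borel_measurable_sum)
      fix j assume j: "j \<in> I"
      note [measurable] = f[OF j]
      have [measurable]: "(\<lambda>w. w j) \<in> borel_measurable ?G" using j by measurable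
      show "(\<lambda>p. (fst p j * sqrt (s j)) * f j (snd p)) \<in> borel_measurable (?G \<Otimes>\<^sub>M M)"
        by measurable
    qed
    then show ?thesis by (simp add: split_beta')
  qed
  have "(\<Sum>j\<in>I. s j * (f j x)\<^sup>2) = (\<Sum>j\<in>I. (sqrt (s j) * f j x)\<^sup>2)" for x
    using s by (simp add: power_mult_distrib)
  then have "(\<integral>\<^sup>+x. ennreal ((\<Sum>j\<in>I. s j * (f j x)\<^sup>2) powr (\<alpha> / 2)) \<partial>M) * ?c
      = (\<integral>\<^sup>+x. ennreal ((\<Sum>j\<in>I. (sqrt (s j) * f j x)\<^sup>2) powr (\<alpha> / 2)) * ?c \<partial>M)"
  proof (subst nn_integral_multc)
    have [measurable]: "(\<lambda>x. \<Sum>j\<in>I. (sqrt (s j) * f j x)\<^sup>2) \<in> borel_measurable M"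
      using f by (intro borel_measurable_sum borel_measurable_power borel_measurable_times) auto
    show "(\<lambda>x. ennreal ((\<Sum>j\<in>I. (sqrt (s j) * f j x)\<^sup>2) powr (\<alpha> / 2))) \<in> borel_measurable M"
      by measurable
  qed simp
  also have "\<dots> = (\<integral>\<^sup>+x. (\<integral>\<^sup>+w. ennreal (\<bar>\<Sum>j\<in>I. w j * (sqrt (s j) * f j x)\<bar> powr \<alpha>) \<partial>?G) \<partial>M)"
    using gauss_linear_moment[OF I \<alpha>] by simp
  also have "\<dots> = (\<integral>\<^sup>+w. (\<integral>\<^sup>+x. ennreal (\<bar>\<Sum>j\<in>I. (w j * sqrt (s j)) * f j x\<bar> powr \<alpha>) \<partial>M) \<partial>?G)"
    using Fubini'[OF meas] by (simp add: mult.assoc)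
  finally show ?thesis .
qed

lemma sum_functional_imp_square_functional:
  fixes f1 :: "'i \<Rightarrow> 'a \<Rightarrow> real" and f2 :: "'i \<Rightarrow> 'b \<Rightarrow> real"
  assumes I: "finite I" and \<alpha>: "0 < \<alpha>" "\<alpha> < 2"
    and M: "sigma_finite_measure M1" "sigma_finite_measure M2"
    and f1: "\<And>j. j \<in> I \<Longrightarrow> f1 j \<in> borel_measurable M1"
    and f2: "\<And>j. j \<in> I \<Longrightarrow> f2 j \<in> borel_measurable M2"
    and eq: "\<And>a. (\<integral>\<^sup>+x. ennreal (\<bar>\<Sum>j\<in>I. a j * f1 j x\<bar> powr \<alpha>) \<partial>M1) =
      (\<integral>\<^sup>+x. ennreal (\<bar>\<Sum>j\<in>I. a j * f2 j x\<bar> powr \<alpha>) \<partial>M2)"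
    and s: "\<And>j. j \<in> I \<Longrightarrow> 0 \<le> s j"
  shows "(\<integral>\<^sup>+x. ennreal ((\<Sum>j\<in>I. s j * (f1 j x)\<^sup>2) powr (\<alpha> / 2)) \<partial>M1) =
    (\<integral>\<^sup>+x. ennreal ((\<Sum>j\<in>I. s j * (f2 j x)\<^sup>2) powr (\<alpha> / 2)) \<partial>M2)"
proof -
  let ?c = "\<integral>\<^sup>+z. ennreal (\<bar>z\<bar> powr \<alpha>) \<partial>gauss"
  have "(\<integral>\<^sup>+x. ennreal ((\<Sum>j\<in>I. s j * (f1 j x)\<^sup>2) powr (\<alpha> / 2)) \<partial>M1) * ?c =
      (\<integral>\<^sup>+x. ennreal ((\<Sum>j\<in>I. s j * (f2 j x)\<^sup>2) powr (\<alpha> / 2)) \<partial>M2) * ?c"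
    by (simp only: gauss_average[where f=f1 and M=M1, OF I \<alpha>(1) f1 M(1) s]
        gauss_average[where f=f2 and M=M2, OF I \<alpha>(1) f2 M(2) s] eq)
  then show ?thesis
    using gauss_moment_finite[OF \<alpha>] gauss_moment_nonzero[of \<alpha>]
    by (auto simp: ennreal_mult_cancel_left mult.commute[of _ ?c])
qed

lemma integrable_min_1_ray_measure:
  assumes g: "\<And>j. j \<in> I \<Longrightarrow> g j \<in> borel_measurable M" "\<And>j x. j \<in> I \<Longrightarrow> 0 \<le> g j x"
    and I: "finite I" and \<beta>: "0 < \<beta>" "\<beta> < 1"
    and j: "j \<in> I" and fin: "(\<integral>\<^sup>+x. ennreal (g j x powr \<beta>) \<partial>M) < \<infinity>"
  shows "integrable (ray_measure \<beta> I M g) (\<lambda>y. min 1 (y j))"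
proof (rule integrableI_nonneg)
  have [measurable]: "(\<lambda>y. y j) \<in> borel_measurable (\<Pi>\<^sub>M j\<in>I. borel)" using j by measurable
  show "(\<lambda>y. min 1 (y j)) \<in> borel_measurable (ray_measure \<beta> I M g)" by measurable
  show "AE y in ray_measure \<beta> I M g. 0 \<le> min 1 (y j)"
  proof -
    have "AE y in ray_measure \<beta> I M g. \<forall>j\<in>I. 0 \<le> y j"
      by (rule AE_ray_measure_nonneg[OF g(1) I g(2)])
    then show ?thesis by eventually_elim (use j in auto)
  qed
  have "(\<integral>\<^sup>+y. ennreal (min 1 (y j)) \<partial>ray_measure \<beta> I M g)
      = (\<integral>\<^sup>+x. ennreal ((\<lambda>j\<in>I. g j x) j powr \<beta>) \<partial>M) * (\<integral>\<^sup>+r. ennreal (min 1 r) \<partial>radial \<beta>)"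
    by (rule nn_integral_ray_measure[OF g(1)]) (use j g \<beta> in auto)
  also have "\<dots> < \<infinity>"
    using fin nn_integral_radial_min_1_finite[OF \<beta>] j by (simp add: ennreal_mult_less_top)
  finally show "(\<integral>\<^sup>+y. ennreal (min 1 (y j)) \<partial>ray_measure \<beta> I M g) < \<infinity>" .
qed

text \<open>For \<open>\<beta> < 1\<close> this is the Laplace exponent of a stable subordinator: homogeneity turns \<open>1 - exp (- t)\<close> into a multiple
  of \<open>t powr \<beta>\<close>.\<close>

lemma nn_integral_ray_measure_Laplace:
  assumes \<beta>: "0 < \<beta>" and g: "\<And>j. j \<in> I \<Longrightarrow> g j \<in> borel_measurable M" "\<And>j x. j \<in> I \<Longrightarrow> 0 \<le> g j x"
    and s: "\<And>j. j \<in> I \<Longrightarrow> 0 \<le> s j"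
  shows "(\<integral>\<^sup>+y. ennreal (1 - exp (- (\<Sum>j\<in>I. s j * y j))) \<partial>ray_measure \<beta> I M g) =
    (\<integral>\<^sup>+x. ennreal ((\<Sum>j\<in>I. s j * g j x) powr \<beta>) \<partial>M) * (\<integral>\<^sup>+r. ennreal (1 - exp (- r)) \<partial>radial \<beta>)"
proof -
  have "(\<integral>\<^sup>+y. ennreal (1 - exp (- (\<Sum>j\<in>I. s j * y j))) \<partial>ray_measure \<beta> I M g) =
    (\<integral>\<^sup>+x. ennreal ((\<Sum>j\<in>I. s j * (\<lambda>j\<in>I. g j x) j) powr \<beta>) \<partial>M) * (\<integral>\<^sup>+r. ennreal (1 - exp (- r))
        \<partial>radial \<beta>)"
    by (rule nn_integral_ray_measure[OF g(1)])
       (use g s \<beta> in \<open>auto simp: sum_distrib_left mult.left_commute intro!: sum_nonneg\<close>)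
  then show ?thesis by simp
qed

text \<open>As a function of \<open>s\<close> the hypothesis concerns the Bernstein functions attached to the two ray measures;
  they determine the masses of all complements of boxes.\<close>

lemma Bernstein_functional_imp_max_functional:
  fixes g1 :: "'i \<Rightarrow> 'a \<Rightarrow> real" and g2 :: "'i \<Rightarrow> 'b \<Rightarrow> real"
  assumes I: "finite I" "I \<noteq> {}" and \<beta>: "0 < \<beta>" "\<beta> < 1"
    and g1: "\<And>j. j \<in> I \<Longrightarrow> g1 j \<in> borel_measurable M1" "\<And>j x. j \<in> I \<Longrightarrow> 0 \<le> g1 j x"
    and g2: "\<And>j. j \<in> I \<Longrightarrow> g2 j \<in> borel_measurable M2" "\<And>j x. j \<in> I \<Longrightarrow> 0 \<le> g2 j x"
    and fin1: "\<And>j. j \<in> I \<Longrightarrow> (\<integral>\<^sup>+x. ennreal (g1 j x powr \<beta>) \<partial>M1) < \<infinity>"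
    and fin2: "\<And>j. j \<in> I \<Longrightarrow> (\<integral>\<^sup>+x. ennreal (g2 j x powr \<beta>) \<partial>M2) < \<infinity>"
    and eq: "\<And>s. (\<And>j. j \<in> I \<Longrightarrow> 0 \<le> s j) \<Longrightarrow>
      (\<integral>\<^sup>+x. ennreal ((\<Sum>j\<in>I. s j * g1 j x) powr \<beta>) \<partial>M1) =
      (\<integral>\<^sup>+x. ennreal ((\<Sum>j\<in>I. s j * g2 j x) powr \<beta>) \<partial>M2)"
    and b: "\<And>j. j \<in> I \<Longrightarrow> 0 \<le> b j"
  shows "(\<integral>\<^sup>+x. ennreal ((MAX j\<in>I. b j * g1 j x) powr \<beta>) \<partial>M1) =
    (\<integral>\<^sup>+x. ennreal ((MAX j\<in>I. b j * g2 j x) powr \<beta>) \<partial>M2)"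
proof -
  have "emeasure (ray_measure \<beta> I M1 g1) {y \<in> space (ray_measure \<beta> I M1 g1). \<exists>j\<in>I. 1 \<le> b j * y j} =
      emeasure (ray_measure \<beta> I M2 g2) {y \<in> space (ray_measure \<beta> I M2 g2). \<exists>j\<in>I. 1 \<le> b j * y j}"
  proof (rule emeasure_eq_of_Laplace)
    show "AE y in ray_measure \<beta> I M1 g1. \<forall>j\<in>I. 0 \<le> y j" "AE y in ray_measure \<beta> I M2 g2. \<forall>j\<in>I. 0 \<le> y j"
      by (rule AE_ray_measure_nonneg[OF g1(1) I(1) g1(2)]
          AE_ray_measure_nonneg[OF g2(1) I(1) g2(2)]; assumption)+
    show "integrable (ray_measure \<beta> I M1 g1) (\<lambda>y. min 1 (y j))" if "j \<in> I" for j
      by (rule integrable_min_1_ray_measure[where g=g1 and M=M1, OF g1 I(1) \<beta> that fin1[OF that]])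
    show "integrable (ray_measure \<beta> I M2 g2) (\<lambda>y. min 1 (y j))" if "j \<in> I" for j
      by (rule integrable_min_1_ray_measure[where g=g2 and M=M2, OF g2 I(1) \<beta> that fin2[OF that]])
  qed (use I b in \<open>auto simp: nn_integral_ray_measure_Laplace[where g=g1 and M=M1, OF \<beta>(1) g1]
      nn_integral_ray_measure_Laplace[where g=g2 and M=M2, OF \<beta>(1) g2] eq\<close>)
  then show ?thesis
    by (simp add: emeasure_ray_measure_tail[where g=g1 and M=M1, OF I g1(1) \<beta>(1) g1(2) b]
        emeasure_ray_measure_tail[where g=g2 and M=M2, OF I g2(1) \<beta>(1) g2(2) b])
qed

lemma MAX_power2:
  fixes x :: "'i \<Rightarrow> real"
  assumes "finite I" "I \<noteq> {}" "\<And>j. j \<in> I \<Longrightarrow> 0 \<le> x j"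
  shows "(MAX j\<in>I. (x j)\<^sup>2) = (MAX j\<in>I. x j)\<^sup>2"
proof -
  obtain k where k: "k \<in> I" "(MAX j\<in>I. x j) = x k"
    using Max_in[of "x ` I"] assms by (auto simp: image_iff)
  have "x j \<le> x k" if "j \<in> I" for j
    using Max_ge[of "x ` I" "x j"] that assms k(2) by simp
  then show ?thesis
    unfolding k(2) using assms k(1) by (intro Max_eqI) (auto intro!: power_mono)
qed

lemma power2_powr_half: "0 \<le> (t::real) \<Longrightarrow> (t\<^sup>2) powr (\<alpha> / 2) = t powr \<alpha>"
  by (cases "t = 0") (simp_all add: powr_powr flip: powr_numeral)

lemma MAX_squares_powr_half:
  assumes I: "finite I" "I \<noteq> {}" and b: "\<And>j. j \<in> I \<Longrightarrow> 0 \<le> b j" and f: "\<And>j x. j \<in> I \<Longrightarrow> 0 \<le> f j x"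
  shows "(MAX j\<in>I. (b j)\<^sup>2 * (f j x)\<^sup>2) powr (\<alpha> / 2) = (MAX j\<in>I. b j * f j x) powr (\<alpha>::real)"
proof -
  have "0 \<le> (MAX j\<in>I. b j * f j x)" using I b f by (auto simp: Max_ge_iff)
  then show ?thesis
    using MAX_power2[OF I, of "\<lambda>j. b j * f j x"] b f
    by (simp add: power_mult_distrib power2_powr_half)
qed

lemma sum_functional_imp_max_functional:
  fixes f1 :: "'i \<Rightarrow> 'a \<Rightarrow> real" and f2 :: "'i \<Rightarrow> 'b \<Rightarrow> real"
  assumes I: "finite I" "I \<noteq> {}" and \<alpha>: "0 < \<alpha>" "\<alpha> < 2"
    and M: "sigma_finite_measure M1" "sigma_finite_measure M2"
    and f1: "\<And>j. j \<in> I \<Longrightarrow> f1 j \<in> borel_measurable M1" "\<And>j x. j \<in> I \<Longrightarrow> 0 \<le> f1 j x"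
    and f2: "\<And>j. j \<in> I \<Longrightarrow> f2 j \<in> borel_measurable M2" "\<And>j x. j \<in> I \<Longrightarrow> 0 \<le> f2 j x"
    and fin1: "\<And>j. j \<in> I \<Longrightarrow> (\<integral>\<^sup>+x. ennreal (f1 j x powr \<alpha>) \<partial>M1) < \<infinity>"
    and fin2: "\<And>j. j \<in> I \<Longrightarrow> (\<integral>\<^sup>+x. ennreal (f2 j x powr \<alpha>) \<partial>M2) < \<infinity>"
    and eq: "\<And>a. (\<integral>\<^sup>+x. ennreal (\<bar>\<Sum>j\<in>I. a j * f1 j x\<bar> powr \<alpha>) \<partial>M1) =
      (\<integral>\<^sup>+x. ennreal (\<bar>\<Sum>j\<in>I. a j * f2 j x\<bar> powr \<alpha>) \<partial>M2)"
    and b: "\<And>j. j \<in> I \<Longrightarrow> 0 \<le> b j"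
  shows "(\<integral>\<^sup>+x. ennreal ((MAX j\<in>I. b j * f1 j x) powr \<alpha>) \<partial>M1) =
    (\<integral>\<^sup>+x. ennreal ((MAX j\<in>I. b j * f2 j x) powr \<alpha>) \<partial>M2)"
proof -
  \<comment> \<open>The weights are squared along with the functions, and the maximum commutes with squaring.\<close>
  have "(\<integral>\<^sup>+x. ennreal ((MAX j\<in>I. (b j)\<^sup>2 * (f1 j x)\<^sup>2) powr (\<alpha> / 2)) \<partial>M1) =
      (\<integral>\<^sup>+x. ennreal ((MAX j\<in>I. (b j)\<^sup>2 * (f2 j x)\<^sup>2) powr (\<alpha> / 2)) \<partial>M2)"
    by (rule Bernstein_functional_imp_max_functional[OF I])
       (use \<alpha> f1 f2 fin1 fin2 sum_functional_imp_square_functional[OF I(1) \<alpha> M f1(1) f2(1) eq]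
        in \<open>auto simp: power2_powr_half\<close>)
  then show ?thesis
    by (simp only: MAX_squares_powr_half[where f=f1 and b=b, OF I b f1(2)]
        MAX_squares_powr_half[where f=f2 and b=b, OF I b f2(2)])
qed

section \<open>Passage to the norms\<close>

text \<open>Finiteness excludes the dummy value of the Bochner integral, so that comparing norms amounts to
  comparing Lebesgue integrals.\<close>

lemma L_norm_eq_iff:
  assumes \<alpha>: "0 < \<alpha>"
    and u1: "u1 \<in> borel_measurable M1" "(\<integral>\<^sup>+x. ennreal (\<bar>u1 x\<bar> powr \<alpha>) \<partial>M1) < \<infinity>"
    and u2: "u2 \<in> borel_measurable M2" "(\<integral>\<^sup>+x. ennreal (\<bar>u2 x\<bar> powr \<alpha>) \<partial>M2) < \<infinity>"
  shows "L_norm \<alpha> M1 u1 = L_norm \<alpha> M2 u2 \<longleftrightarrow>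
    (\<integral>\<^sup>+x. ennreal (\<bar>u1 x\<bar> powr \<alpha>) \<partial>M1) = (\<integral>\<^sup>+x. ennreal (\<bar>u2 x\<bar> powr \<alpha>) \<partial>M2)"
proof -
  have inj: "p powr (1 / \<alpha>) = q powr (1 / \<alpha>) \<longleftrightarrow> p = q" if "0 \<le> p" "0 \<le> q" for p q :: real
    using powr_less_mono2[of "1 / \<alpha>" p q] powr_less_mono2[of "1 / \<alpha>" q p] that \<alpha>
    by (cases p q rule: linorder_cases) auto
  have int: "(\<integral>x. \<bar>u x\<bar> powr \<alpha> \<partial>M) = enn2real (\<integral>\<^sup>+x. ennreal (\<bar>u x\<bar> powr \<alpha>) \<partial>M)"
    if "u \<in> borel_measurable M" for u and M :: "'c measure"
    using that by (intro integral_eq_nn_integral) auto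
  show ?thesis
    unfolding L_norm_def int[OF u1(1)] int[OF u2(1)]
    using u1(2) u2(2) by (subst inj) (auto simp: less_top dest!: arg_cong[where f=ennreal])
qed

lemma L_norm_cong_AE:
  assumes "u \<in> borel_measurable M" "v \<in> borel_measurable M" "AE x in M. u x = v x"
  shows "L_norm \<alpha> M u = L_norm \<alpha> M v"
proof -
  have "(\<integral>x. \<bar>u x\<bar> powr \<alpha> \<partial>M) = (\<integral>x. \<bar>v x\<bar> powr \<alpha> \<partial>M)"
    using assms by (intro integral_cong_AE) auto
  then show ?thesis by (simp add: L_norm_def)
qed

lemma
  fixes a :: "'i \<Rightarrow> real"
  assumes I: "finite I" and f: "\<And>j. j \<in> I \<Longrightarrow> f j \<in> borel_measurable M"
    and g: "\<And>j. j \<in> I \<Longrightarrow> g j \<in> borel_measurable M" and eq: "AE x in M. \<forall>j\<in>I. f j x = g j x"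
  shows L_norm_sum_cong_AE: "L_norm \<alpha> M (\<lambda>x. \<Sum>j\<in>I. a j * f j x) = L_norm \<alpha> M (\<lambda>x. \<Sum>j\<in>I. a j * g j x)"
    and L_norm_Max_cong_AE: "L_norm \<alpha> M (\<lambda>x. MAX j\<in>I. a j * f j x) =
        L_norm \<alpha> M (\<lambda>x. MAX j\<in>I. a j * g j x)"
proof -
  show "L_norm \<alpha> M (\<lambda>x. \<Sum>j\<in>I. a j * f j x) = L_norm \<alpha> M (\<lambda>x. \<Sum>j\<in>I. a j * g j x)"
    using eq f g by (intro L_norm_cong_AE) (auto elim!: eventually_mono intro!: sum.cong)
  show "L_norm \<alpha> M (\<lambda>x. MAX j\<in>I. a j * f j x) = L_norm \<alpha> M (\<lambda>x. MAX j\<in>I. a j * g j x)"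
  proof (rule L_norm_cong_AE)
    show "AE x in M. (MAX j\<in>I. a j * f j x) = (MAX j\<in>I. a j * g j x)"
      using eq by eventually_elim (simp cong: image_cong)
  qed (use I f g in \<open>auto intro!: borel_measurable_Max\<close>)
qed

lemma nn_integral_powr_abs_mult_finite:
  assumes "(\<integral>\<^sup>+x. ennreal (f x powr \<alpha>) \<partial>M) < \<infinity>" "\<And>x. 0 \<le> f x" "f \<in> borel_measurable M"
  shows "(\<integral>\<^sup>+x. ennreal (\<bar>c * f x\<bar> powr \<alpha>) \<partial>M) < \<infinity>"
proof -
  have "(\<integral>\<^sup>+x. ennreal (\<bar>c * f x\<bar> powr \<alpha>) \<partial>M) = (\<integral>\<^sup>+x. ennreal (\<bar>c\<bar> powr \<alpha>) * ennreal (f x powr \<alpha>) \<partial>M)"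
    using assms by (simp add: abs_mult powr_mult ennreal_mult)
  also have "\<dots> = ennreal (\<bar>c\<bar> powr \<alpha>) * (\<integral>\<^sup>+x. ennreal (f x powr \<alpha>) \<partial>M)"
    using assms by (intro nn_integral_cmult) auto
  finally show ?thesis using assms by (simp add: ennreal_mult_less_top)
qed

lemma nn_integral_sum_functional_finite:
  assumes I: "finite I" and \<alpha>: "0 < \<alpha>"
    and f: "\<And>j. j \<in> I \<Longrightarrow> f j \<in> borel_measurable M" "\<And>j x. j \<in> I \<Longrightarrow> 0 \<le> f j x"
    and fin: "\<And>j. j \<in> I \<Longrightarrow> (\<integral>\<^sup>+x. ennreal (f j x powr \<alpha>) \<partial>M) < \<infinity>"
  shows "(\<integral>\<^sup>+x. ennreal (\<bar>\<Sum>j\<in>I. a j * f j x\<bar> powr \<alpha>) \<partial>M) < \<infinity>"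
proof -
  have "\<bar>\<Sum>j\<in>I. a j * f j x\<bar> powr \<alpha> \<le> (\<Sum>j\<in>I. \<bar>(card I * a j) * f j x\<bar> powr \<alpha>)" for x
    using powr_abs_sum_le[OF I \<alpha>, of "\<lambda>j. a j * f j x"] by (simp add: abs_mult mult.assoc)
  then have "(\<integral>\<^sup>+x. ennreal (\<bar>\<Sum>j\<in>I. a j * f j x\<bar> powr \<alpha>) \<partial>M)
      \<le> (\<integral>\<^sup>+x. (\<Sum>j\<in>I. ennreal (\<bar>(card I * a j) * f j x\<bar> powr \<alpha>)) \<partial>M)"
    by (intro nn_integral_mono) (simp add: ennreal_leI)
  also have "\<dots> = (\<Sum>j\<in>I. \<integral>\<^sup>+x. ennreal (\<bar>(card I * a j) * f j x\<bar> powr \<alpha>) \<partial>M)"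
    using f by (intro nn_integral_sum) auto
  also have "\<dots> < \<infinity>"
    using I f fin nn_integral_powr_abs_mult_finite[where \<alpha>=\<alpha> and M=M] by (auto simp: less_top)
  finally show ?thesis .
qed

lemma nn_integral_max_functional_finite:
  assumes I: "finite I" "I \<noteq> {}"
    and f: "\<And>j. j \<in> I \<Longrightarrow> f j \<in> borel_measurable M" "\<And>j x. j \<in> I \<Longrightarrow> 0 \<le> f j x"
    and fin: "\<And>j. j \<in> I \<Longrightarrow> (\<integral>\<^sup>+x. ennreal (f j x powr \<alpha>) \<partial>M) < \<infinity>"
  shows "(\<integral>\<^sup>+x. ennreal (\<bar>MAX j\<in>I. a j * f j x\<bar> powr \<alpha>) \<partial>M) < \<infinity>"
proof -
  have "(\<integral>\<^sup>+x. ennreal (\<bar>MAX j\<in>I. a j * f j x\<bar> powr \<alpha>) \<partial>M)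
      \<le> (\<integral>\<^sup>+x. (\<Sum>j\<in>I. ennreal (\<bar>a j * f j x\<bar> powr \<alpha>)) \<partial>M)"
    using powr_abs_Max_le[OF I] by (intro nn_integral_mono) (simp add: ennreal_leI)
  also have "\<dots> = (\<Sum>j\<in>I. \<integral>\<^sup>+x. ennreal (\<bar>a j * f j x\<bar> powr \<alpha>) \<partial>M)"
    using f by (intro nn_integral_sum) auto
  also have "\<dots> < \<infinity>"
    using I f fin nn_integral_powr_abs_mult_finite[where \<alpha>=\<alpha> and M=M] by (auto simp: less_top)
  finally show ?thesis .
qed

theorem theorem3p1:
  fixes \<alpha> :: real and n :: nat
    and M1 :: "'a measure" and M2 :: "'b measure"
    and f1 :: "nat \<Rightarrow> 'a \<Rightarrow> real" and f2 :: "nat \<Rightarrow> 'b \<Rightarrow> real"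
  assumes "0 < \<alpha>" and "\<alpha> < 2" and "1 \<le> n"
    and "sigma_finite_measure M1" and "sigma_finite_measure M2"
    and "\<And>j. j \<in> {1..n} \<Longrightarrow> f1 j \<in> L_plus \<alpha> M1"
    and "\<And>j. j \<in> {1..n} \<Longrightarrow> f2 j \<in> L_plus \<alpha> M2"
  shows "(\<forall>a :: nat \<Rightarrow> real.
            L_norm \<alpha> M1 (\<lambda>x. \<Sum>j\<in>{1..n}. a j * f1 j x) =
            L_norm \<alpha> M2 (\<lambda>x. \<Sum>j\<in>{1..n}. a j * f2 j x))
     \<longleftrightarrow>
         (\<forall>a :: nat \<Rightarrow> real. (\<forall>j\<in>{1..n}. 0 \<le> a j) \<longrightarrow>
            L_norm \<alpha> M1 (\<lambda>x. MAX j\<in>{1..n}. a j * f1 j x) =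
            L_norm \<alpha> M2 (\<lambda>x. MAX j\<in>{1..n}. a j * f2 j x))"
proof -
  let ?I = "{1..n}"
  have I: "finite ?I" "?I \<noteq> {}" using \<open>1 \<le> n\<close> by auto
  \<comment> \<open>Representatives that are nonnegative everywhere; they change no norm.\<close>
  define g1 where "g1 j x = max 0 (f1 j x)" for j x
  define g2 where "g2 j x = max 0 (f2 j x)" for j x
  have pos: "0 \<le> g1 j x" "0 \<le> g2 j y" for j x y by (simp_all add: g1_def g2_def)
  have plus: "f j \<in> borel_measurable M" "(\<lambda>x. max 0 (f j x)) \<in> borel_measurable M"
      "(\<integral>\<^sup>+x. ennreal (max 0 (f j x) powr \<alpha>) \<partial>M) < \<infinity>" "AE x in M. f j x = max 0 (f j x)"
    if "f j \<in> L_plus \<alpha> M" for f :: "nat \<Rightarrow> 'c \<Rightarrow> real" and j M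
  proof -
    show [measurable]: "f j \<in> borel_measurable M" using that by (simp add: L_plus_def L_space_def)
    show "(\<lambda>x. max 0 (f j x)) \<in> borel_measurable M" by measurable
    show "AE x in M. f j x = max 0 (f j x)" using that by (auto simp: L_plus_def)
    have "integrable M (\<lambda>x. \<bar>f j x\<bar> powr \<alpha>)" using that by (simp add: L_plus_def L_space_def)
    then have "(\<integral>\<^sup>+x. ennreal (\<bar>f j x\<bar> powr \<alpha>) \<partial>M) < \<infinity>"
      by (subst nn_integral_eq_integral) auto
    moreover have "(\<integral>\<^sup>+x. ennreal (max 0 (f j x) powr \<alpha>) \<partial>M) \<le> (\<integral>\<^sup>+x. ennreal (\<bar>f j x\<bar> powr \<alpha>) \<partial>M)"
      using \<open>0 < \<alpha>\<close> by (intro nn_integral_mono ennreal_leI powr_mono2) auto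
    ultimately show "(\<integral>\<^sup>+x. ennreal (max 0 (f j x) powr \<alpha>) \<partial>M) < \<infinity>" by (rule le_less_trans[rotated])
  qed
  note p1 = plus[of f1, OF assms(6), folded g1_def] and p2 = plus[of f2, OF assms(7), folded g2_def]
  have ae1: "AE x in M1. \<forall>j\<in>?I. f1 j x = g1 j x" and ae2: "AE x in M2. \<forall>j\<in>?I. f2 j x = g2 j x"
    by (rule AE_finite_allI[OF I(1)], erule p1(4) p2(4))+
  have sum_iff: "L_norm \<alpha> M1 (\<lambda>x. \<Sum>j\<in>?I. a j * f1 j x) = L_norm \<alpha> M2 (\<lambda>x. \<Sum>j\<in>?I. a j * f2 j x) \<longleftrightarrow>
      (\<integral>\<^sup>+x. ennreal (\<bar>\<Sum>j\<in>?I. a j * g1 j x\<bar> powr \<alpha>) \<partial>M1) =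
      (\<integral>\<^sup>+x. ennreal (\<bar>\<Sum>j\<in>?I. a j * g2 j x\<bar> powr \<alpha>) \<partial>M2)" for a
    by (simp only: L_norm_sum_cong_AE[where f=f1 and g=g1 and M=M1, OF I(1) p1(1,2) ae1]
        L_norm_sum_cong_AE[where f=f2 and g=g2 and M=M2, OF I(1) p2(1,2) ae2])
       (intro L_norm_eq_iff \<open>0 < \<alpha>\<close> borel_measurable_sum borel_measurable_times
           borel_measurable_const p1(2) p2(2) nn_integral_sum_functional_finite I pos p1(3) p2(3))
  have max_iff: "L_norm \<alpha> M1 (\<lambda>x. MAX j\<in>?I. a j * f1 j x) = L_norm \<alpha> M2 (\<lambda>x. MAX j\<in>?I. a j * f2 j x) \<longleftrightarrow>
      (\<integral>\<^sup>+x. ennreal ((MAX j\<in>?I. a j * g1 j x) powr \<alpha>) \<partial>M1) =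
      (\<integral>\<^sup>+x. ennreal ((MAX j\<in>?I. a j * g2 j x) powr \<alpha>) \<partial>M2)"
    and max_fin: "(\<integral>\<^sup>+x. ennreal ((MAX j\<in>?I. a j * g1 j x) powr \<alpha>) \<partial>M1) < \<infinity>"
    if a: "\<And>j. j \<in> ?I \<Longrightarrow> 0 \<le> a j" for a
  proof -
    have "0 \<le> (MAX j\<in>?I. a j * g j x)" if "\<And>j x. 0 \<le> g j x" for g and x :: 'c
      using I a that by (auto simp: Max_ge_iff)
    note nonneg = this[of g1, OF pos(1)] this[of g2, OF pos(2)]
    have "L_norm \<alpha> M1 (\<lambda>x. MAX j\<in>?I. a j * f1 j x) = L_norm \<alpha> M2 (\<lambda>x. MAX j\<in>?I. a j * f2 j x) \<longleftrightarrow>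
      (\<integral>\<^sup>+x. ennreal (\<bar>MAX j\<in>?I. a j * g1 j x\<bar> powr \<alpha>) \<partial>M1) =
      (\<integral>\<^sup>+x. ennreal (\<bar>MAX j\<in>?I. a j * g2 j x\<bar> powr \<alpha>) \<partial>M2)"
      by (simp only: L_norm_Max_cong_AE[where f=f1 and g=g1 and M=M1, OF I(1) p1(1,2) ae1]
        L_norm_Max_cong_AE[where f=f2 and g=g2 and M=M2, OF I(1) p2(1,2) ae2])
       (intro L_norm_eq_iff \<open>0 < \<alpha>\<close> borel_measurable_Max borel_measurable_times
           borel_measurable_const p1(2) p2(2) nn_integral_max_functional_finite I pos p1(3) p2(3))
    then show "L_norm \<alpha> M1 (\<lambda>x. MAX j\<in>?I. a j * f1 j x) = L_norm \<alpha> M2 (\<lambda>x. MAX j\<in>?I. a j * f2 j x) \<longleftrightarrow>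
      (\<integral>\<^sup>+x. ennreal ((MAX j\<in>?I. a j * g1 j x) powr \<alpha>) \<partial>M1) =
      (\<integral>\<^sup>+x. ennreal ((MAX j\<in>?I. a j * g2 j x) powr \<alpha>) \<partial>M2)"
      by (simp only: abs_of_nonneg[OF nonneg(1)] abs_of_nonneg[OF nonneg(2)])
    show "(\<integral>\<^sup>+x. ennreal ((MAX j\<in>?I. a j * g1 j x) powr \<alpha>) \<partial>M1) < \<infinity>"
      using nn_integral_max_functional_finite[where f=g1 and M=M1, OF I p1(2) pos(1) p1(3), of a]
      by (simp only: abs_of_nonneg[OF nonneg(1)])
  qed
  show ?thesis
  proof (intro iffI allI impI)
    fix b :: "nat \<Rightarrow> real"
    assume H: "\<forall>a. L_norm \<alpha> M1 (\<lambda>x. \<Sum>j\<in>?I. a j * f1 j x) = L_norm \<alpha> M2 (\<lambda>x. \<Sum>j\<in>?I. a j * f2 j x)"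
      and b: "\<forall>j\<in>?I. 0 \<le> b j"
    have sums: "(\<integral>\<^sup>+x. ennreal (\<bar>\<Sum>j\<in>?I. a j * g1 j x\<bar> powr \<alpha>) \<partial>M1) =
        (\<integral>\<^sup>+x. ennreal (\<bar>\<Sum>j\<in>?I. a j * g2 j x\<bar> powr \<alpha>) \<partial>M2)" for a
      using H by (simp only: sum_iff)
    have "(\<integral>\<^sup>+x. ennreal ((MAX j\<in>?I. b j * g1 j x) powr \<alpha>) \<partial>M1) =
        (\<integral>\<^sup>+x. ennreal ((MAX j\<in>?I. b j * g2 j x) powr \<alpha>) \<partial>M2)"
      by (intro sum_functional_imp_max_functional[OF I assms(1,2,4,5)] p1(2,3) p2(2,3) pos sums)
         (use b in auto)
    then show "L_norm \<alpha> M1 (\<lambda>x. MAX j\<in>?I. b j * f1 j x) = L_norm \<alpha> M2 (\<lambda>x. MAX j\<in>?I. b j * f2 j x)"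
      using b by (subst max_iff) auto
  next
    fix a :: "nat \<Rightarrow> real"
    assume H: "\<forall>a. (\<forall>j\<in>?I. 0 \<le> a j) \<longrightarrow>
      L_norm \<alpha> M1 (\<lambda>x. MAX j\<in>?I. a j * f1 j x) = L_norm \<alpha> M2 (\<lambda>x. MAX j\<in>?I. a j * f2 j x)"
    have "(\<integral>\<^sup>+x. ennreal (\<bar>\<Sum>j\<in>?I. a j * g1 j x\<bar> powr \<alpha>) \<partial>M1) =
        (\<integral>\<^sup>+x. ennreal (\<bar>\<Sum>j\<in>?I. a j * g2 j x\<bar> powr \<alpha>) \<partial>M2)"
      by (intro max_functional_imp_sum_functional[OF I \<open>0 < \<alpha>\<close>] p1(2) p2(2) pos max_fin)
         (use H max_iff in auto)
    then show "L_norm \<alpha> M1 (\<lambda>x. \<Sum>j\<in>?I. a j * f1 j x) = L_norm \<alpha> M2 (\<lambda>x. \<Sum>j\<in>?I. a j * f2 j x)"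
      by (simp only: sum_iff)
  qed
qed

end
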